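(* Let $K,L$ be fields, let $\alpha:Q(K)\to Q(L)$ be a hyperfield isomorphism between their quadratic hyperfields, and let $v$ be a valuation on $K$ such that $\Gamma_v$ is finitely generated as an abelian group. Suppose that either (i) the basic part $B((1+M_v)K^{*2})$ of $(1+M_v)K^{*2}$ is $U_vK^{*2}$, and $(1+M_v)K^{*2}$ is unexceptional, or (ii) the basic part of $(1+M_v)K^{*2}$ is $(1+M_v)K^{*2}$, and $(1+M_v)K^{*2}$ has index $2$ in $U_vK^{*2}$. Then there exists a valuation $w$ on $L$ such that the image of $(1+M_v)K^{*2}/K^{*2}$ under $\alpha$ is $(1+M_w)L^{*2}/L^{*2}$ and $(L^*:U_wL^{*2})\ge(K^*:U_vK^{*2})$. If (i) holds, then the image of $U_vK^{*2}/K^{*2}$ under $\alpha$ is $U_wL^{*2}/L^{*2}$.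
   Context: For a field $K$, the quadratic hyperfield $Q(K)$ has underlying set $\{0\}\cup K^*/K^{*2}$, with the induced multiplication and negation, and multivalued addition: $\overline a+0=0+\overline a=\{\overline a\}$; for $a,b\in K^*$, $\overline a+\overline b=Q(K)$ if $\overline b=-\overline a$, and otherwise $\overline a+\overline b=\{\overline a,\overline b\}\cup\{\overline{ax^2+by^2}:x,y\in K^*\}$. A hyperfield isomorphism $Q(K)\to Q(L)$ is a bijection preserving $0$, $1$, multiplication, negation and (as sets) the multivalued addition; in particular it restricts to a group isomorphism $K^*/K^{*2}\to L^*/L^{*2}$. For a valuation $v$ on $K$ (written additively; the trivial valuation is allowed), $\Gamma_v$ is the value group, $M_v$ the maximal ideal of the valuation ring, and $U_v$ the unit group of the valuation ring. For a subgroup $T\subseteq K^*$, an element $x\in K^*$ is $T$-rigid if $T+Tx\subseteq T\cup Tx$ (sums taken in $K$). The basic part of $T$ is $B(T)=\{x\in K^*:\text{ either }x\text{ or }-x\text{ is not }T\text{-rigid}\}$. $T$ is exceptional if $B(T)=\pm T$ and either $-1\in T$ or $T$ is additively closed; otherwise $T$ is unexceptional. *)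

theory Defs
  imports "HOL-Algebra.Generated_Groups" "HOL-Library.Equipollence"
begin

section \<open>The multiplicative group of a field\<close>

text \<open>
  Fields are types of class \<open>field\<close>; their multiplicative groups, quotients of these, and
  value groups are treated as HOL-Algebra groups.
\<close>

definition mult_group :: "'a::field monoid" where
  "mult_group = \<lparr>carrier = UNIV - {0}, mult = (*), one = 1\<rparr>"

definition nonzero_squares :: "'a::field set" where
  "nonzero_squares = {x\<^sup>2 | x. x \<noteq> 0}"

text \<open>
  For \<open>S \<subseteq> T\<close> subgroups of the multiplicative group, this is the underlying set of the
  quotient \<open>T/S\<close>, so its cardinality is the index of \<open>S\<close> in \<open>T\<close>.
\<close>
definition quotient_set :: "'a::field set \<Rightarrow> 'a set \<Rightarrow> 'a set set" where
  "quotient_set T S = carrier ((mult_group\<lparr>carrier := T\<rparr>) Mod S)"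


section \<open>Hyperfield structures and the quadratic hyperfield\<close>

record 'h hyper = "'h monoid" +
  hzero :: 'h
  hneg :: "'h \<Rightarrow> 'h"
  hadd :: "'h \<Rightarrow> 'h \<Rightarrow> 'h set"

definition hyperfield_iso :: "'h hyper \<Rightarrow> 'k hyper \<Rightarrow> ('h \<Rightarrow> 'k) \<Rightarrow> bool" where
  "hyperfield_iso H K f \<longleftrightarrow>
     bij_betw f (carrier H) (carrier K) \<and>
     f (hzero H) = hzero K \<and>
     f (one H) = one K \<and>
     (\<forall>x\<in>carrier H. \<forall>y\<in>carrier H. f (mult H x y) = mult K (f x) (f y)) \<and>
     (\<forall>x\<in>carrier H. f (hneg H x) = hneg K (f x)) \<and>
     (\<forall>x\<in>carrier H. \<forall>y\<in>carrier H. f ` hadd H x y = hadd K (f x) (f y))"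

text \<open>
  The class of \<open>a\<close> is the coset of \<open>a\<close> modulo nonzero squares if \<open>a \<noteq> 0\<close>, and the class
  of \<open>0\<close> is \<open>{0}\<close>, which plays the role of the zero element.
\<close>
definition quad_class :: "'a::field \<Rightarrow> 'a set" where
  "quad_class a = nonzero_squares #>\<^bsub>mult_group\<^esub> a"

definition quad_carrier :: "'a::field set set" where
  "quad_carrier = insert {0} (carrier (mult_group Mod nonzero_squares))"

text \<open>
  In the last case \<open>A = aK\<^sup>*\<^sup>2\<close> and \<open>B = bK\<^sup>*\<^sup>2\<close> are nonzero classes, so that \<open>s \<in> A\<close> and
  \<open>t \<in> B\<close> range over the elements \<open>ax\<^sup>2\<close> and \<open>by\<^sup>2\<close> with \<open>x, y\<close> nonzero;
  see \<open>quad_add_classes\<close> below.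
\<close>
definition quad_add :: "'a::field set \<Rightarrow> 'a set \<Rightarrow> 'a set set" where
  "quad_add A B =
     (if A = {0} then {B}
      else if B = {0} then {A}
      else if B = uminus ` A then quad_carrier
      else {A, B} \<union> {quad_class (s + t) | s t. s \<in> A \<and> t \<in> B})"

text \<open>
  The product of two classes is their elementwise product, and the negative of a class its
  elementwise negative; see \<open>quad_mult_classes\<close> and \<open>quad_neg_class\<close>.
\<close>
definition quad_hyperfield :: "'a::field set hyper" where
  "quad_hyperfield =
     \<lparr>carrier = quad_carrier, mult = set_mult mult_group, one = nonzero_squares,
      hzero = {0}, hneg = image uminus, hadd = quad_add\<rparr>"

lemma quad_class_eq: "quad_class (a::'a::field) = {a * x\<^sup>2 | x. x \<noteq> 0}"
  by (auto simp: quad_class_def nonzero_squares_def r_coset_def mult_group_def mult.commute)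

lemma quad_class_0: "quad_class (0::'a::field) = {0}"
  unfolding quad_class_eq by (auto intro: exI[of _ 1])

lemma quad_class_1: "quad_class (1::'a::field) = nonzero_squares"
  by (simp add: quad_class_eq nonzero_squares_def)

lemma quad_carrier_eq: "quad_carrier = range (quad_class :: 'a::field \<Rightarrow> 'a set)"
proof -
  have "carrier (mult_group Mod nonzero_squares) = (quad_class :: 'a \<Rightarrow> _) ` (UNIV - {0})"
    by (auto simp: FactGroup_def RCOSETS_def quad_class_def mult_group_def)
  moreover have "range (quad_class :: 'a \<Rightarrow> _) = insert (quad_class 0) (quad_class ` (UNIV - {0}))"
    by auto
  ultimately show ?thesis
    by (simp add: quad_carrier_def quad_class_0)
qed

lemma quad_mult_classes:
  "quad_class (a::'a::field) <#>\<^bsub>mult_group\<^esub> quad_class b = quad_class (a * b)"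
proof -
  have "\<exists>x y. a * b * z\<^sup>2 = (a * x\<^sup>2) * (b * y\<^sup>2) \<and> x \<noteq> 0 \<and> y \<noteq> 0" if "z \<noteq> 0" for z
    using that by (intro exI[of _ z] exI[of _ 1]) simp
  moreover have "\<exists>z. (a * x\<^sup>2) * (b * y\<^sup>2) = a * b * z\<^sup>2 \<and> z \<noteq> 0" if "x \<noteq> 0" "y \<noteq> 0" for x y
    using that by (intro exI[of _ "x * y"]) (simp add: power_mult_distrib)
  ultimately show ?thesis
    unfolding quad_class_eq set_mult_def mult_group_def by (fastforce simp: mult_ac)
qed

lemma quad_neg_class: "uminus ` quad_class (a::'a::field) = quad_class (- a)"
  unfolding quad_class_eq by force

lemma quad_add_classes:
  fixes a b :: "'a::field"
  assumes "a \<noteq> 0" "b \<noteq> 0"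
  shows "quad_add (quad_class a) (quad_class b) =
    (if quad_class b = quad_class (- a) then quad_carrier
     else {quad_class a, quad_class b} \<union>
       {quad_class (a * x\<^sup>2 + b * y\<^sup>2) | x y. x \<noteq> 0 \<and> y \<noteq> 0})"
proof -
  have "quad_class c \<noteq> {0}" if "c \<noteq> 0" for c :: 'a
    using that unfolding quad_class_eq by (auto simp: set_eq_iff intro!: exI[of _ 0])
  moreover have "{quad_class (s + t) | s t. s \<in> quad_class a \<and> t \<in> quad_class b} =
      {quad_class (a * x\<^sup>2 + b * y\<^sup>2) | x y. x \<noteq> 0 \<and> y \<noteq> 0}"
    by (subst (2 3) quad_class_eq) blast
  ultimately show ?thesis
    using assms by (simp add: quad_add_def quad_neg_class)
qed


section \<open>Valuations\<close>

text \<open>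
  Value groups are carrier-based because the theorem asserts the existence of a valuation, and
  one cannot quantify existentially over types. They are records extending
  \<^typ>\<open>'g monoid\<close> and hence written multiplicatively: \<open>mult G\<close> and \<open>one G\<close> are the
  \<open>+\<close> and \<open>0\<close> of the usual additive notation. The order is not reversed.
\<close>

record 'g ordered_monoid = "'g monoid" +
  gle :: "'g \<Rightarrow> 'g \<Rightarrow> bool"

locale linordered_abelian_group = comm_group G for G :: "'g ordered_monoid" (structure) +
  assumes gle_refl: "a \<in> carrier G \<Longrightarrow> gle G a a"
    and gle_antisym:
      "\<lbrakk>a \<in> carrier G; b \<in> carrier G; gle G a b; gle G b a\<rbrakk> \<Longrightarrow> a = b"
    and gle_trans:
      "\<lbrakk>a \<in> carrier G; b \<in> carrier G; c \<in> carrier G; gle G a b; gle G b c\<rbrakk> \<Longrightarrow> gle G a c"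
    and gle_linear:
      "\<lbrakk>a \<in> carrier G; b \<in> carrier G\<rbrakk> \<Longrightarrow> gle G a b \<or> gle G b a"
    and gle_mult_mono:
      "\<lbrakk>a \<in> carrier G; b \<in> carrier G; c \<in> carrier G; gle G a b\<rbrakk>
        \<Longrightarrow> gle G (a \<otimes> c) (b \<otimes> c)"

text \<open>
  The value at \<open>0\<close> would be \<open>\<infinity>\<close>; instead, \<open>v\<close> is only considered on nonzero elements. The
  axiom \<open>val_add\<close> says \<open>v (x + y) \<ge> min (v x) (v y)\<close>. As \<open>v\<close> need not be onto
  \<open>carrier G\<close>, the value group is the image of \<open>v\<close>.
\<close>
locale field_valuation = linordered_abelian_group G
  for G :: "'g ordered_monoid" (structure) and v :: "'a::field \<Rightarrow> 'g" +
  assumes val_hom: "v \<in> hom mult_group G"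
    and val_add: "\<lbrakk>x \<noteq> 0; y \<noteq> 0; x + y \<noteq> 0\<rbrakk>
      \<Longrightarrow> gle G (v x) (v (x + y)) \<or> gle G (v y) (v (x + y))"

definition value_group :: "('a::field \<Rightarrow> 'g) \<Rightarrow> 'g set" where
  "value_group v = v ` carrier mult_group"

definition finitely_generated_subgroup :: "('g, 'm) monoid_scheme \<Rightarrow> 'g set \<Rightarrow> bool" where
  "finitely_generated_subgroup G A \<longleftrightarrow> (\<exists>S. finite S \<and> S \<subseteq> A \<and> generate G S = A)"

definition val_ring :: "'g ordered_monoid \<Rightarrow> ('a::field \<Rightarrow> 'g) \<Rightarrow> 'a set" where
  "val_ring G v = {x. x = 0 \<or> gle G (one G) (v x)}"

definition val_units :: "'g ordered_monoid \<Rightarrow> ('a::field \<Rightarrow> 'g) \<Rightarrow> 'a set" where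
  "val_units G v = {x \<in> val_ring G v. \<exists>y\<in>val_ring G v. x * y = 1}"

text \<open>The maximal ideal of the (local) valuation ring consists of its non-units.\<close>
definition val_max :: "'g ordered_monoid \<Rightarrow> ('a::field \<Rightarrow> 'g) \<Rightarrow> 'a set" where
  "val_max G v = val_ring G v - val_units G v"

lemma (in field_valuation) val_closed: "x \<noteq> 0 \<Longrightarrow> v x \<in> carrier G"
  using val_hom by (auto simp: hom_def mult_group_def)

lemma (in field_valuation) val_mult: "\<lbrakk>x \<noteq> 0; y \<noteq> 0\<rbrakk> \<Longrightarrow> v (x * y) = v x \<otimes> v y"
  using val_hom by (auto simp: hom_def mult_group_def)

lemma (in field_valuation) val_one: "v 1 = \<one>"
  using val_mult[of 1 1] val_closed[of 1] l_cancel_one'[of "v 1" "v 1"] by simp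

lemma (in field_valuation) val_units_iff: "x \<in> val_units G v \<longleftrightarrow> x \<noteq> 0 \<and> v x = \<one>"
proof
  assume "x \<in> val_units G v"
  then obtain y where xy: "x \<in> val_ring G v" "y \<in> val_ring G v" "x * y = 1"
    by (auto simp: val_units_def)
  then have nz: "x \<noteq> 0" "y \<noteq> 0"
    by auto
  have c: "v x \<in> carrier G" "v y \<in> carrier G" and m: "v x \<otimes> v y = \<one>"
    using nz val_closed val_mult[of x y] val_one xy(3) by auto
  have "gle G \<one> (v x)" "gle G \<one> (v y)"
    using xy nz by (auto simp: val_ring_def)
  moreover from this have "gle G (v x) \<one>"
    using gle_mult_mono[of \<one> "v y" "v x"] c m by (simp add: m_comm)
  ultimately have "v x = \<one>"
    using gle_antisym c by auto
  with nz show "x \<noteq> 0 \<and> v x = \<one>" by simp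
next
  assume x: "x \<noteq> 0 \<and> v x = \<one>"
  then have "v (inverse x) = \<one>"
    using val_mult[of x "inverse x"] val_closed[of "inverse x"] val_one by simp
  then show "x \<in> val_units G v"
    using x gle_refl by (auto simp: val_units_def val_ring_def intro!: exI[of _ "inverse x"])
qed

lemma (in field_valuation) val_max_iff:
  "x \<in> val_max G v \<longleftrightarrow> x = 0 \<or> (gle G \<one> (v x) \<and> v x \<noteq> \<one>)"
  by (auto simp: val_max_def val_units_iff val_ring_def)

text \<open>The subgroups \<open>(1 + M\<^sub>v)K\<^sup>*\<^sup>2\<close> and \<open>U\<^sub>vK\<^sup>*\<^sup>2\<close> of \<open>K\<^sup>*\<close>\<close>

definition one_units_squares :: "'g ordered_monoid \<Rightarrow> ('a::field \<Rightarrow> 'g) \<Rightarrow> 'a set" where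
  "one_units_squares G v = {1 + m | m. m \<in> val_max G v} <#>\<^bsub>mult_group\<^esub> nonzero_squares"

definition units_squares :: "'g ordered_monoid \<Rightarrow> ('a::field \<Rightarrow> 'g) \<Rightarrow> 'a set" where
  "units_squares G v = val_units G v <#>\<^bsub>mult_group\<^esub> nonzero_squares"


section \<open>Rigid elements\<close>

definition rigid :: "'a::field set \<Rightarrow> 'a \<Rightarrow> bool" where
  "rigid T x \<longleftrightarrow> {s + t * x | s t. s \<in> T \<and> t \<in> T} \<subseteq> T \<union> {t * x | t. t \<in> T}"

definition basic_part :: "'a::field set \<Rightarrow> 'a set" where
  "basic_part T = {x. x \<noteq> 0 \<and> (\<not> rigid T x \<or> \<not> rigid T (- x))}"

definition exceptional :: "'a::field set \<Rightarrow> bool" where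
  "exceptional T \<longleftrightarrow>
     basic_part T = T \<union> uminus ` T \<and> (- 1 \<in> T \<or> (\<forall>s\<in>T. \<forall>t\<in>T. s + t \<in> T))"

end

theory Submission
  imports Defs
begin

text \<open>
  Let \<open>T \<subseteq> H\<close> be subgroups of \<open>K\<^sup>*\<close> containing the squares, such that all elements outside \<open>H\<close>
  are \<open>T\<close>-rigid. In the manner of Ware and of Arason, Elman and Jacob, a valuation ring is built
  from the infinitesimals \<open>{x \<notin> H. 1 + x \<in> T}\<close> and the elements of \<open>H\<close> that multiply these into
  themselves; it satisfies \<open>1 + M \<subseteq> T\<close> and \<open>U \<subseteq> H\<close>, provided that the infinitesimals are symmetric and
  their products behave well. These conditions hold if \<open>T\<close> is unexceptional, and in general after
  enlarging \<open>H\<close> by an index of at most 2.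

  A hyperfield isomorphism transports subgroups, rigidity, basic parts and exceptionality. Hence the
  image \<open>T'\<close> of \<open>T = (1 + M\<^sub>v)K\<^sup>*\<^sup>2\<close> yields a valuation \<open>w\<close> on \<open>L\<close> with \<open>1 + M\<^sub>w \<subseteq> T'\<close>. Pulling
  \<open>S' = (1 + M\<^sub>w)L\<^sup>*\<^sup>2\<close> back to \<open>S \<subseteq> T\<close> and applying the construction to \<open>S\<close> gives another valuation
  on \<open>K\<close>, comparable with \<open>v\<close>. A strictly coarser valuation would have units outside \<open>U\<^sub>vK\<^sup>*\<^sup>2\<close>,
  since a nonzero convex subgroup of the finitely generated group \<open>\<Gamma>\<^sub>v\<close> is not 2-divisible, and the
  hypotheses leave no room for these unless \<open>S = T\<close>. A valuation refining \<open>v\<close> gives \<open>T \<subseteq> S\<close> at once.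
\<close>

section \<open>Valuation rings from rigid elements\<close>

text \<open>The ring found on L yields only an inclusion of 1 + M_w in T'. Equality cannot be tested
  on L, because finite generation is known for the value group of v alone; this is why the argument
  returns to K with S. The basic part of S' lies in U_w L^*2, hence that of S lies in the preimage V
  of U_w L^*2. By the choice of w, V is contained in U_v K^*2 under (i), and in T together with one
  further coset gT under (ii). These bounds leave no room for the units of a strictly coarser ring.
  Exceptionality enters as follows. The construction wants a non-rigid element outside -T, from
  which the symmetry of the infinitesimals and the rest can be derived. An unexceptional T has such
  an element, an exceptional one does not. Without it the construction may fail, but each way of
  failing exhibits an infinitesimal a that acts as a unit on all infinitesimals outside the union of
  H and aH, so one enlargement by the coset of a repairs everything. The extra coset is also why
  comparing indices under (ii) needs an argument: U_w L^*2 may then have a preimage not contained in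
  U_v K^*2.\<close>

text \<open>
  Since \<open>S\<close> contains the squares, it is closed under inverses, and \<open>x * y \<in> S\<close> says that \<open>x\<close> and
  \<open>y\<close> lie in the same coset of \<open>S\<close>. Equality of cosets is expressed in this way throughout.
\<close>
locale square_subgroup =
  fixes S :: "'a::field set"
  assumes square_mem: "x \<noteq> 0 \<Longrightarrow> x * x \<in> S"
    and zero_notin: "0 \<notin> S"
    and mult_mem: "\<lbrakk>x \<in> S; y \<in> S\<rbrakk> \<Longrightarrow> x * y \<in> S"
begin

lemma one_mem: "1 \<in> S"
  using square_mem[of 1] by simp

lemma nonzero: "x \<in> S \<Longrightarrow> x \<noteq> 0"
  using zero_notin by auto

lemma square_cancel: "a \<noteq> 0 \<Longrightarrow> a * a * b \<in> S \<longleftrightarrow> b \<in> S"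
proof
  assume a: "a \<noteq> 0" and ab: "a * a * b \<in> S"
  have "(inverse a * inverse a) * (a * a * b) \<in> S"
    using a ab square_mem mult_mem by (meson nonzero_imp_inverse_nonzero)
  then show "b \<in> S" using a by (simp add: field_simps)
qed (use square_mem mult_mem in blast)

lemma mult_cancel: "a \<in> S \<Longrightarrow> a * b \<in> S \<longleftrightarrow> b \<in> S"
  using mult_mem[of a "a * b"] mult_mem[of a b] square_cancel[of a b] nonzero
  by (auto simp: mult.assoc)

lemma mult_cancel_right: "a \<in> S \<Longrightarrow> b * a \<in> S \<longleftrightarrow> b \<in> S"
  using mult_cancel[of a b] by (simp add: mult.commute)

lemma inverse_iff: "inverse a \<in> S \<longleftrightarrow> a \<in> S"
proof (cases "a = 0")
  case False
  then show ?thesis using square_cancel[of a "inverse a"] by (simp add: mult.assoc)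
qed simp

lemma divide_iff: "a / b \<in> S \<longleftrightarrow> a * b \<in> S"
proof (cases "b = 0")
  case False
  then have "b * b * (a / b) = a * b" by simp
  then show ?thesis using square_cancel[OF False, of "a / b"] by metis
qed simp

lemma same_class_trans:
  assumes "a * b \<in> S" "b * c \<in> S" shows "a * c \<in> S"
proof -
  have "b \<noteq> 0" using assms zero_notin by auto
  moreover have "b * b * (a * c) \<in> S"
    using mult_mem[OF assms] by (simp add: ac_simps)
  ultimately show ?thesis using square_cancel by blast
qed

lemma same_class_mem: "a * b \<in> S \<Longrightarrow> a \<in> S \<longleftrightarrow> b \<in> S"
  using mult_cancel mult_cancel_right by blast

end

locale val_subring =
  fixes R :: "'a::field set"
  assumes zero_mem: "0 \<in> R"
    and one_mem: "1 \<in> R"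
    and add_mem: "\<lbrakk>x \<in> R; y \<in> R\<rbrakk> \<Longrightarrow> x + y \<in> R"
    and mult_mem: "\<lbrakk>x \<in> R; y \<in> R\<rbrakk> \<Longrightarrow> x * y \<in> R"
    and inverse_mem: "x \<notin> R \<Longrightarrow> inverse x \<in> R"

definition ring_units :: "'a::field set \<Rightarrow> 'a set" where
  "ring_units R = {x \<in> R. x \<noteq> 0 \<and> inverse x \<in> R}"

text \<open>\<open>rigid_outside\<close> treats only the sum \<open>1 + x\<close>. As
  \<open>T \<subseteq> H\<close>, scaling by \<open>T\<close> does not leave the complement of
  \<open>H\<close>, and \<open>sum_class\<close> recovers the rule for arbitrary cosets.\<close>

locale rigid_pair = T: square_subgroup T + H: square_subgroup H
  for T H :: "'a::field set" +
  assumes T_sub: "T \<subseteq> H"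
    and minus_one: "- 1 \<in> H"
    and rigid_outside: "\<lbrakk>x \<noteq> 0; x \<notin> H\<rbrakk> \<Longrightarrow> 1 + x \<in> T \<or> (1 + x) * x \<in> T"
begin

definition infinitesimals :: "'a set" where
  "infinitesimals = {x. x \<noteq> 0 \<and> x \<notin> H \<and> 1 + x \<in> T}"

lemma infinitesimalsD:
  "x \<in> infinitesimals \<Longrightarrow> x \<noteq> 0" "x \<in> infinitesimals \<Longrightarrow> x \<notin> H"
  "x \<in> infinitesimals \<Longrightarrow> x \<notin> T" "x \<in> infinitesimals \<Longrightarrow> 1 + x \<in> T"
  using T_sub by (auto simp: infinitesimals_def)

lemma infinitesimalsI: "\<lbrakk>x \<noteq> 0; x \<notin> H; 1 + x \<in> T\<rbrakk> \<Longrightarrow> x \<in> infinitesimals"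
  by (auto simp: infinitesimals_def)

lemma uminus_H_iff: "- x \<in> H \<longleftrightarrow> x \<in> H"
  using H.mult_cancel[OF minus_one, of x] by simp

text \<open>\<open>1 + inverse x\<close> is \<open>1 + x\<close> divided by \<open>x\<close>, so the
  two alternatives of rigidity say that \<open>x\<close> or \<open>inverse x\<close> is
  infinitesimal; they exclude each other because \<open>x \<notin> T\<close>.\<close>

lemma inverse_infinitesimal_iff:
  assumes "x \<noteq> 0" "x \<notin> H"
  shows "inverse x \<in> infinitesimals \<longleftrightarrow> x \<notin> infinitesimals"
proof -
  have "1 + inverse x = (1 + x) / x" using assms by (simp add: field_simps)
  then have *: "1 + inverse x \<in> T \<longleftrightarrow> (1 + x) * x \<in> T" using T.divide_iff by simp
  show ?thesis
    using assms rigid_outside[OF assms] * T.mult_cancel[of "1 + x" x] T_sub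
    by (auto simp: infinitesimals_def H.inverse_iff)
qed

text \<open>Division by \<open>p\<close> reduces this to rigidity of \<open>q / p\<close>, which
  lies outside \<open>H\<close> because \<open>a * b\<close> does.\<close>

lemma sum_class:
  assumes "p * a \<in> T" "q * b \<in> T" "a * b \<notin> H"
  shows "(p + q) * a \<in> T \<or> (p + q) * b \<in> T"
proof -
  have nz: "p \<noteq> 0" "q \<noteq> 0" "a \<noteq> 0" "b \<noteq> 0" using assms T.zero_notin by auto
  have "(p * a) * (q * b) \<in> H" using T.mult_mem[OF assms(1,2)] T_sub by blast
  then have "(p * q) * (a * b) \<in> H" by (simp add: ac_simps)
  then have pq: "p * q \<notin> H" using H.same_class_mem assms(3) by blast
  then have "q / p \<notin> H" by (simp add: H.divide_iff mult.commute)
  then have "1 + q / p \<in> T \<or> (1 + q / p) * (q / p) \<in> T"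
    using rigid_outside[of "q / p"] nz by simp
  moreover have "1 + q / p = (p + q) / p" "(1 + q / p) * (q / p) = ((p + q) * q) / (p * p)"
    using nz by (simp_all add: field_simps)
  moreover have "((p + q) * q) / (p * p) \<in> T \<longleftrightarrow> (p + q) * q \<in> T"
    using T.divide_iff[of "(p + q) * q" "p * p"] T.mult_cancel_right[OF T.square_mem[OF nz(1)]] by simp
  ultimately have "(p + q) * p \<in> T \<or> (p + q) * q \<in> T" by (simp add: T.divide_iff)
  then show ?thesis using T.same_class_trans assms(1,2) by blast
qed

text \<open>\<open>(1 + x) * (1 + y) = (1 + x * y) + (x + y)\<close> is in \<open>T\<close>. If
  \<open>x * y\<close> were not infinitesimal, the right side would add an element of the coset of
  \<open>x * y\<close> to one of the coset of \<open>x\<close> or \<open>y\<close>, and so lie in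
  one of these cosets, none of which is \<open>T\<close>.\<close>

lemma infinitesimals_mult:
  assumes "x \<in> infinitesimals" "y \<in> infinitesimals" "x * y \<notin> H"
  shows "x * y \<in> infinitesimals"
proof (rule ccontr)
  assume n: "x * y \<notin> infinitesimals"
  have nz: "x \<noteq> 0" "y \<noteq> 0" using assms infinitesimalsD by auto
  have a: "(1 + x * y) * (x * y) \<in> T"
    using n rigid_outside[of "x * y"] nz assms(3) infinitesimalsI[of "x * y"] by auto
  have b: "(x + y) * x \<in> T \<or> (x + y) * y \<in> T"
    by (rule sum_class) (use nz T.square_mem assms in auto)
  have tot: "(1 + x * y) + (x + y) \<in> T"
    using T.mult_mem[of "1 + x" "1 + y"] infinitesimalsD assms by (simp add: algebra_simps)
  have xy: "x * y * x \<notin> H" "x * y * y \<notin> H"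
    using H.square_cancel[of x y] H.square_cancel[of y x] nz assms infinitesimalsD(2)
    by (auto simp: ac_simps)
  show False
    using b
  proof
    assume "(x + y) * x \<in> T"
    from sum_class[OF a this xy(1)] show False
      using T.mult_cancel[OF tot] assms T_sub infinitesimalsD by auto
  next
    assume "(x + y) * y \<in> T"
    from sum_class[OF a this xy(2)] show False
      using T.mult_cancel[OF tot] assms T_sub infinitesimalsD by auto
  qed
qed

text \<open>Split \<open>1 - x * y\<close> as \<open>(1 + x) - x * (1 + y)\<close>, a sum from the
  cosets of \<open>1\<close> and \<open>- x\<close>.\<close>

lemma one_minus_mult_class:
  assumes "x \<in> infinitesimals" "y \<in> infinitesimals"
  shows "1 - x * y \<in> T \<or> (1 - x * y) * - x \<in> T"
proof -
  have "(1 + x) * 1 \<in> T" using assms infinitesimalsD by simp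
  moreover have "(- x * (1 + y)) * (- x) \<in> T"
    using T.mult_mem[of "x * x" "1 + y"] T.square_mem assms infinitesimalsD by (simp add: ac_simps)
  moreover have "1 * (- x) \<notin> H" using assms infinitesimalsD uminus_H_iff by simp
  ultimately have "((1 + x) + (- x * (1 + y))) * 1 \<in> T \<or> ((1 + x) + (- x * (1 + y))) * (- x) \<in> T"
    by (rule sum_class)
  moreover have "(1 + x) + (- x * (1 + y)) = 1 - x * y" by (simp add: algebra_simps)
  ultimately show ?thesis by (simp only: mult_1_right)
qed

lemma one_minus_mult_failure:
  assumes "x \<in> infinitesimals" "y \<in> infinitesimals" "1 - x * y \<notin> T"
  shows "(1 - x * y) * - x \<in> T" "x * y \<in> T"
proof -
  show 1: "(1 - x * y) * - x \<in> T" using one_minus_mult_class assms by blast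
  have "(1 - x * y) * - y \<in> T" using one_minus_mult_class[of y x] assms by (simp add: mult.commute)
  then have "(- x) * (1 - x * y) \<in> T" "(1 - x * y) * - y \<in> T" using 1 by (simp_all add: mult.commute)
  then have "(- x) * (- y) \<in> T" by (rule T.same_class_trans)
  then show "x * y \<in> T" by simp
qed

text \<open>Otherwise \<open>b * y\<close> and \<open>x / b\<close> are infinitesimals with the same
  product \<open>x * y\<close>. The failure for this pair puts \<open>1 - x * y\<close> into the
  coset of \<open>- (b * y)\<close>, the failure for \<open>y\<close>, \<open>x\<close> into that of
  \<open>- y\<close>, so that \<open>b \<in> T\<close>.\<close>

lemma one_minus_mult_failure_unit:
  assumes x: "x \<in> infinitesimals" and y: "y \<in> infinitesimals" and n: "1 - x * y \<notin> T"
    and b: "b \<in> infinitesimals" "b * x \<notin> H"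
  shows "b / x \<in> infinitesimals"
proof (rule ccontr)
  assume bx: "b / x \<notin> infinitesimals"
  have nz: "x \<noteq> 0" "y \<noteq> 0" "b \<noteq> 0" using assms infinitesimalsD by auto
  have "b / x \<notin> H" using b H.divide_iff by simp
  then have xb: "x / b \<in> infinitesimals"
    using inverse_infinitesimal_iff[of "b / x"] bx nz by simp
  have "x * y \<in> T" by (rule one_minus_mult_failure(2)[OF x y n])
  then have "b * y \<notin> H"
    using b(2) T_sub H.same_class_trans[of b y x] by (metis mult.commute subsetD)
  then have bby: "b * y \<in> infinitesimals" using infinitesimals_mult b y by blast
  have eq: "1 - (b * y) * (x / b) = 1 - x * y" using nz by simp
  have "(1 - x * y) * - (b * y) \<in> T"
    using one_minus_mult_failure(1)[OF bby xb] eq n by simp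
  moreover have "(- y) * (1 - x * y) \<in> T"
    using one_minus_mult_failure(1)[OF y x] n by (simp add: mult.commute)
  ultimately have "(- y) * - (b * y) \<in> T" using T.same_class_trans by blast
  then have "y * y * b \<in> T" by (simp add: ac_simps)
  then show False using T.square_cancel nz b infinitesimalsD by blast
qed

end

text \<open>\<open>mult3_same_class\<close> concerns three elements of one coset of
  \<open>H\<close>; when only \<open>x * y \<in> H\<close> is known, \<open>mult3\<close> gets the
  rest from \<open>infinitesimals_mult\<close>.\<close>

locale rigid_pair_valuation = rigid_pair +
  assumes sym: "x \<in> infinitesimals \<Longrightarrow> - x \<in> infinitesimals"
    and one_minus_mult: "\<lbrakk>x \<in> infinitesimals; y \<in> infinitesimals\<rbrakk> \<Longrightarrow> 1 - x * y \<in> T"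
    and mult3_same_class: "\<lbrakk>x \<in> infinitesimals; y \<in> infinitesimals; z \<in> infinitesimals;
      x * y \<in> H; x * z \<in> H; y * z \<in> H\<rbrakk> \<Longrightarrow> x * y * z \<in> infinitesimals"
begin

definition multipliers :: "'a set" where
  "multipliers = {x \<in> H. \<forall>y\<in>infinitesimals. x * y \<in> infinitesimals}"

definition rigid_ring :: "'a set" where
  "rigid_ring = insert 0 (infinitesimals \<union> multipliers)"

lemma multipliersD: "\<lbrakk>x \<in> multipliers; y \<in> infinitesimals\<rbrakk> \<Longrightarrow> x * y \<in> infinitesimals"
  "\<lbrakk>x \<in> multipliers; y \<in> infinitesimals\<rbrakk> \<Longrightarrow> y * x \<in> infinitesimals" "x \<in> multipliers \<Longrightarrow> x \<in> H"
  by (auto simp: multipliers_def mult.commute)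

lemma mult3:
  assumes "x \<in> infinitesimals" "y \<in> infinitesimals" "z \<in> infinitesimals" "x * y \<in> H"
  shows "x * y * z \<in> infinitesimals"
proof -
  have nH: "x * y * z \<notin> H" using H.mult_cancel[OF assms(4)] assms infinitesimalsD by simp
  consider "x * z \<in> H" "y * z \<in> H" | "x * z \<notin> H" | "y * z \<notin> H" by blast
  then show ?thesis
  proof cases
    case 1 then show ?thesis using mult3_same_class assms by blast
  next
    case 2
    then have "(x * z) * y \<in> infinitesimals"
      using infinitesimals_mult assms nH by (metis mult.assoc mult.commute)
    then show ?thesis by (simp add: ac_simps)
  next
    case 3
    then have "(y * z) * x \<in> infinitesimals"
      using infinitesimals_mult assms nH by (metis mult.assoc mult.commute)
    then show ?thesis by (simp add: ac_simps)
  qed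
qed

lemma mult_infinitesimals: "\<lbrakk>x \<in> infinitesimals; y \<in> infinitesimals\<rbrakk>
    \<Longrightarrow> x * y \<in> infinitesimals \<union> multipliers"
  using infinitesimals_mult[of x y] mult3[of x y] by (auto simp: multipliers_def)

text \<open>Since \<open>inverse x = y * inverse (x * y)\<close>, the inverse of a non-multiplier in
  \<open>H\<close> is a product of two infinitesimals. All later uses rest on this.\<close>

lemma not_multiplierE:
  assumes "x \<in> H" "x \<notin> multipliers"
  obtains y where "y \<in> infinitesimals" "inverse (x * y) \<in> infinitesimals"
proof -
  obtain y where y: "y \<in> infinitesimals" "x * y \<notin> infinitesimals"
    using assms by (auto simp: multipliers_def)
  moreover have "x * y \<notin> H" using H.mult_cancel[OF assms(1)] y infinitesimalsD by simp
  moreover have "x * y \<noteq> 0" using y assms infinitesimalsD H.nonzero by auto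
  ultimately show ?thesis using inverse_infinitesimal_iff that by blast
qed

text \<open>Otherwise \<open>inverse (1 + x)\<close> is a product of two infinitesimals, and
  \<open>one_minus_mult\<close> puts \<open>1 - inverse (1 + x) = x / (1 + x)\<close> into
  \<open>T\<close>, whence \<open>x \<in> T\<close>.\<close>

lemma one_plus_multiplier:
  assumes x: "x \<in> infinitesimals" shows "1 + x \<in> multipliers"
proof (rule ccontr)
  assume "1 + x \<notin> multipliers"
  moreover have "1 + x \<in> H" using x infinitesimalsD T_sub by blast
  ultimately obtain y where y: "y \<in> infinitesimals" and v: "inverse ((1 + x) * y) \<in> infinitesimals"
    using not_multiplierE by blast
  have nz: "1 + x \<noteq> 0" "y \<noteq> 0" using x y infinitesimalsD T.nonzero by blast+
  have "y * inverse ((1 + x) * y) = inverse (1 + x)" "1 - inverse (1 + x) = x / (1 + x)"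
    using nz by (simp, simp add: field_simps)
  then have "1 - y * inverse ((1 + x) * y) = x / (1 + x)" by metis
  then have "x / (1 + x) \<in> T" using one_minus_mult[OF y v] by simp
  then show False using T.divide_iff T.mult_cancel_right x infinitesimalsD by blast
qed

lemma inverse_one_plus_multiplier:
  assumes x: "x \<in> infinitesimals" shows "inverse (1 + x) \<in> multipliers"
proof -
  have nz: "1 + x \<noteq> 0" using x infinitesimalsD T.nonzero by blast
  have eq: "1 + - (x / (1 + x)) = inverse (1 + x)" using nz by (simp add: field_simps)
  have "- (x / (1 + x)) \<in> infinitesimals"
  proof (rule infinitesimalsI)
    show "- (x / (1 + x)) \<noteq> 0" using nz x infinitesimalsD by auto
    show "- (x / (1 + x)) \<notin> H"
      using x infinitesimalsD T_sub H.mult_cancel_right[of "1 + x" x]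
      unfolding uminus_H_iff H.divide_iff by blast
    show "1 + - (x / (1 + x)) \<in> T" unfolding eq using x infinitesimalsD by (simp add: T.inverse_iff)
  qed
  then show ?thesis using one_plus_multiplier eq by metis
qed

text \<open>\<open>1 - y * v\<close> is a product of two factors \<open>1 + z\<close> with
  \<open>z\<close> infinitesimal, and the inverses of such factors are multipliers.\<close>

lemma one_minus_mult_multiplier:
  assumes y: "y \<in> infinitesimals" and v: "v \<in> infinitesimals"
  shows "inverse (1 - y * v) \<in> multipliers"
proof -
  have nz: "1 + y \<noteq> 0" using y infinitesimalsD T.nonzero by blast
  let ?y = "- (y * (1 + v) * inverse (1 + y))"
  have "?y \<in> infinitesimals"
    by (intro sym multipliersD(2) inverse_one_plus_multiplier one_plus_multiplier y v)
  then have m: "inverse (1 + ?y) \<in> multipliers" by (rule inverse_one_plus_multiplier)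
  have "1 - y * v = (1 + y) * (1 + ?y)" using nz by (simp add: field_simps)
  then have eq: "inverse (1 - y * v) = inverse (1 + y) * inverse (1 + ?y)" by simp
  show ?thesis
    unfolding eq multipliers_def
    using m inverse_one_plus_multiplier[OF y] multipliersD H.mult_mem by (auto simp: mult.assoc)
qed

lemma mult_rigid_ring: "\<lbrakk>x \<in> rigid_ring; y \<in> rigid_ring\<rbrakk> \<Longrightarrow> x * y \<in> rigid_ring"
proof -
  have "x * y \<in> multipliers" if "x \<in> multipliers" "y \<in> multipliers" for x y
    using that by (auto simp: multipliers_def mult.assoc H.mult_mem)
  then show "\<lbrakk>x \<in> rigid_ring; y \<in> rigid_ring\<rbrakk> \<Longrightarrow> x * y \<in> rigid_ring"
    using mult_infinitesimals multipliersD by (auto simp: rigid_ring_def)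
qed

lemma one_plus_rigid_ring:
  assumes "x \<in> rigid_ring" shows "1 + x \<in> rigid_ring"
proof -
  consider "x = 0" | "1 + x = 0" | "x \<in> infinitesimals"
    | "x \<in> multipliers" "1 + x \<noteq> 0" "1 + x \<notin> H" | "x \<in> multipliers" "1 + x \<noteq> 0" "1 + x \<in> H"
    using assms by (auto simp: rigid_ring_def)
  then show ?thesis
  proof cases
    case 1 then show ?thesis by (auto simp: rigid_ring_def multipliers_def H.one_mem)
  next
    case 2 then show ?thesis by (simp add: rigid_ring_def)
  next
    case 3 then show ?thesis using one_plus_multiplier by (simp add: rigid_ring_def)
  next
    case 4
    have "1 + x \<in> infinitesimals"
    proof (rule ccontr)
      assume "1 + x \<notin> infinitesimals"
      then have "- inverse (1 + x) \<in> infinitesimals"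
        using sym inverse_infinitesimal_iff 4 by blast
      then have "1 + - inverse (1 + x) \<in> T" using infinitesimalsD by blast
      moreover have "1 + - inverse (1 + x) = x / (1 + x)" using 4 by (simp add: field_simps)
      ultimately have "x * (1 + x) \<in> H" using T_sub T.divide_iff by auto
      then show False using H.mult_cancel 4 multipliersD by blast
    qed
    then show ?thesis by (simp add: rigid_ring_def)
  next
    case 5
    have "1 + x \<in> multipliers"
    proof (rule ccontr)
      assume "1 + x \<notin> multipliers"
      then obtain y where y: "y \<in> infinitesimals" and v: "inverse ((1 + x) * y) \<in> infinitesimals"
        using not_multiplierE 5 by blast
      let ?v = "inverse ((1 + x) * y)"
      have nz: "x \<noteq> 0" "y \<noteq> 0"
        using infinitesimalsD(1)[OF v] infinitesimalsD(1)[OF y] H.nonzero[OF multipliersD(3)[OF 5(1)]]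
        by simp_all
      \<comment> \<open>Because \<open>1 - y * ?v = x / (1 + x)\<close>, this product is
        \<open>inverse y\<close>, which cannot be infinitesimal together with
        \<open>y\<close>.\<close>
      have "inverse (1 - y * ?v) * (x * ?v) \<in> infinitesimals"
        using one_minus_mult_multiplier[OF y v] v 5 multipliersD(1) by blast
      moreover have "y * ?v = inverse (1 + x)" "1 - inverse (1 + x) = x / (1 + x)"
        using nz 5(2) by (simp, simp add: field_simps)
      then have "1 - y * ?v = x / (1 + x)" by metis
      moreover have "inverse (x / (1 + x)) * (x * ?v) = inverse y" using nz 5(2) by simp
      ultimately have "inverse y \<in> infinitesimals" by metis
      then show False using y inverse_infinitesimal_iff infinitesimalsD by metis
    qed
    then show ?thesis by (simp add: rigid_ring_def)
  qed
qed

lemma inverse_rigid_ring: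
  assumes "x \<noteq> 0" "x \<notin> rigid_ring" shows "inverse x \<in> rigid_ring"
proof (cases "x \<in> H")
  case True
  then obtain y where y: "y \<in> infinitesimals" "inverse (x * y) \<in> infinitesimals"
    using not_multiplierE assms by (auto simp: rigid_ring_def)
  then have "inverse x = y * inverse (x * y)" using infinitesimalsD(1)[of y] by (cases "x = 0") auto
  then have "inverse x \<in> infinitesimals \<union> multipliers" using mult_infinitesimals[OF y] by metis
  then show ?thesis by (simp add: rigid_ring_def)
next
  case False
  then show ?thesis using assms inverse_infinitesimal_iff by (auto simp: rigid_ring_def)
qed

lemma val_subring_rigid_ring: "val_subring rigid_ring"
proof -
  have add: "x + y \<in> rigid_ring" if "x \<in> rigid_ring" "y \<in> rigid_ring" for x y
  proof -
    have *: "x + y \<in> rigid_ring" if "x \<in> rigid_ring" "y / x \<in> rigid_ring" "x \<noteq> 0" for x y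
    proof -
      have "x + y = x * (1 + y / x)" using that by (simp add: field_simps)
      then show ?thesis using mult_rigid_ring one_plus_rigid_ring that by metis
    qed
    show ?thesis
    proof (cases "x = 0 \<or> y = 0")
      case True then show ?thesis using that by auto
    next
      case False
      then have "y / x \<in> rigid_ring \<or> x / y \<in> rigid_ring" using inverse_rigid_ring[of "y / x"] by auto
      then show ?thesis using * that False by (metis add.commute)
    qed
  qed
  have "1 \<in> multipliers" by (auto simp: multipliers_def H.one_mem)
  then have one: "1 \<in> rigid_ring" by (simp add: rigid_ring_def)
  show ?thesis
  proof
    show 0: "0 \<in> rigid_ring" by (simp add: rigid_ring_def)
    show "inverse x \<in> rigid_ring" if "x \<notin> rigid_ring" for x
      using inverse_rigid_ring[OF _ that] that 0 by blast
  qed (fact | rule add mult_rigid_ring; assumption)+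
qed

lemma ring_units_rigid_ring: "ring_units rigid_ring \<subseteq> H"
proof
  fix x assume "x \<in> ring_units rigid_ring"
  then have x: "x \<noteq> 0" "x \<in> rigid_ring" "inverse x \<in> rigid_ring" by (auto simp: ring_units_def)
  show "x \<in> H"
  proof (rule ccontr)
    assume "x \<notin> H"
    then show False using x inverse_infinitesimal_iff[of x] multipliersD(3) H.inverse_iff
      by (auto simp: rigid_ring_def)
  qed
qed

text \<open>In the case of a multiplier, \<open>not_multiplierE\<close> applied to
  \<open>inverse x\<close> writes \<open>x\<close> as a product of two infinitesimals; a change of
  sign brings \<open>1 + x\<close> into the form of \<open>one_minus_mult\<close>.\<close>

lemma one_plus_max_rigid_ring:
  assumes "x \<in> rigid_ring - ring_units rigid_ring" shows "1 + x \<in> T"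
proof -
  consider "x = 0" | "x \<in> infinitesimals" | "x \<in> multipliers" "inverse x \<notin> multipliers"
    using assms multipliersD(3) H.nonzero by (fastforce simp: rigid_ring_def ring_units_def)
  then show ?thesis
  proof cases
    case 1 then show ?thesis by (simp add: T.one_mem)
  next
    case 2 then show ?thesis using infinitesimalsD by blast
  next
    case 3
    then obtain y where y: "y \<in> infinitesimals" "inverse (inverse x * y) \<in> infinitesimals"
      using not_multiplierE[of "inverse x"] multipliersD(3) H.inverse_iff by blast
    then have "1 - (- y) * inverse (inverse x * y) \<in> T" using one_minus_mult sym by blast
    moreover have "1 - (- y) * inverse (inverse x * y) = 1 + x" using infinitesimalsD(1)[OF y(1)]
      by (cases "x = 0") (simp_all add: field_simps)
    ultimately show ?thesis by metis
  qed
qed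

end

section \<open>Criteria for a rigid pair to yield a valuation ring\<close>

definition compatible :: "'a::field set \<Rightarrow> 'a set \<Rightarrow> bool" where
  "compatible T R \<longleftrightarrow> val_subring R \<and> (\<forall>m\<in>R - ring_units R. 1 + m \<in> T)"

context rigid_pair begin

text \<open>\<open>1 + x * y * z = (1 + x) - x * (1 - y * z)\<close> lies in \<open>T\<close> or in
  the coset of \<open>- x\<close>. If it is not in \<open>T\<close>, permuting the factors and
  changing two signs puts it into the cosets of \<open>- y\<close>, \<open>- z\<close> and
  \<open>x\<close> as well, so all of these coincide.\<close>

lemma mult3_failure:
  assumes sym: "\<And>x. x \<in> infinitesimals \<Longrightarrow> - x \<in> infinitesimals"
    and om: "\<And>x y. \<lbrakk>x \<in> infinitesimals; y \<in> infinitesimals\<rbrakk> \<Longrightarrow> 1 - x * y \<in> T"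
    and x: "x \<in> infinitesimals" and y: "y \<in> infinitesimals" and z: "z \<in> infinitesimals"
    and H: "x * y \<in> H" and n: "x * y * z \<notin> infinitesimals"
  shows "- 1 \<in> T" "x * y \<in> T" "y * z \<in> T" "inverse (x * y * z) \<in> infinitesimals"
proof -
  have nz: "x \<noteq> 0" "y \<noteq> 0" "z \<noteq> 0" using x y z infinitesimalsD by auto
  have nH: "x * y * z \<notin> H" using H.mult_cancel[OF H] z infinitesimalsD by simp
  show "inverse (x * y * z) \<in> infinitesimals"
    using n nH nz inverse_infinitesimal_iff[of "x * y * z"] by simp
  have key: "(1 + x * y * z) * - x \<in> T"
    if "x \<in> infinitesimals" "y \<in> infinitesimals" "z \<in> infinitesimals" "1 + x * y * z \<notin> T"
    for x y z
  proof -
    have nz: "x \<noteq> 0" using that infinitesimalsD by auto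
    have "(1 + x) * 1 \<in> T" using that infinitesimalsD by simp
    moreover have "(- x * (1 - y * z)) * (- x) \<in> T"
      using T.mult_mem[OF T.square_mem[OF nz] om[OF that(2,3)]] by (simp add: ac_simps)
    moreover have "1 * (- x) \<notin> H" using that infinitesimalsD uminus_H_iff by simp
    ultimately have
      "((1 + x) + (- x * (1 - y * z))) * 1 \<in> T \<or> ((1 + x) + (- x * (1 - y * z))) * (- x) \<in> T"
      by (rule sum_class)
    moreover have "(1 + x) + (- x * (1 - y * z)) = 1 + x * y * z" by (simp add: algebra_simps)
    ultimately show ?thesis using that(4) by (simp only: mult_1_right) blast
  qed
  have c: "1 + x * y * z \<notin> T" using infinitesimalsI[OF _ nH] n nz by (metis mult_eq_0_iff)
  have a1: "(1 + x * y * z) * - x \<in> T" by (rule key[OF x y z c])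
  have a2: "(1 + x * y * z) * - y \<in> T" using key[OF y x z] c by (simp add: ac_simps)
  have a3: "(1 + x * y * z) * - z \<in> T" using key[OF z y x] c by (simp add: ac_simps)
  have a4: "(1 + x * y * z) * x \<in> T" using key[OF sym[OF x] sym[OF y] z] c by simp
  have tr: "p * q \<in> T" if "(1 + x * y * z) * p \<in> T" "(1 + x * y * z) * q \<in> T" for p q
    using T.same_class_trans[of p "1 + x * y * z" q] that by (simp add: mult.commute)
  show "- 1 \<in> T" using tr[OF a1 a4] T.square_cancel[of x "- 1"] nz by simp
  show "x * y \<in> T" using tr[OF a1 a2] by simp
  show "y * z \<in> T" using tr[OF a2 a3] by simp
qed

text \<open>Given symmetry, the other two conditions can fail only if \<open>- 1 \<in> T\<close>.
  For \<open>1 - x * y\<close> this is excluded by \<open>om\<close>; for triple products it is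
  excluded by \<open>c\<close>, which acts as a unit on the infinitesimals but moves
  \<open>x * y\<close> out of \<open>T\<close>.\<close>

lemma valuation_of_sym:
  assumes sym: "\<And>x. x \<in> infinitesimals \<Longrightarrow> - x \<in> infinitesimals"
    and om: "\<And>x y. \<lbrakk>x \<in> infinitesimals; y \<in> infinitesimals; - 1 \<in> T; x * y \<in> T\<rbrakk> \<Longrightarrow> 1 - x * y \<in> T"
    and c: "- 1 \<in> T \<Longrightarrow> c \<noteq> 0 \<and> c \<notin> T \<and>
      (\<forall>b\<in>infinitesimals. c * b \<in> infinitesimals \<and> b / c \<in> infinitesimals)"
  shows "rigid_pair_valuation T H"
proof unfold_locales
  show om': "1 - x * y \<in> T" if x: "x \<in> infinitesimals" and y: "y \<in> infinitesimals" for x y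
  proof (rule ccontr)
    assume n: "1 - x * y \<notin> T"
    have "x \<noteq> 0" using x infinitesimalsD by blast
    have 1: "(1 - x * y) * - x \<in> T" and xy: "x * y \<in> T" using one_minus_mult_failure[OF x y n] .
    have "(1 - (- x) * (- y)) * - (- x) \<in> T"
      using one_minus_mult_failure(1)[of "- x" "- y"] x y sym n by simp
    then have "x * (1 - x * y) \<in> T" by (simp add: mult.commute)
    from T.same_class_trans[OF this 1] have "x * x * - 1 \<in> T" by simp
    then have "- 1 \<in> T" using T.square_cancel \<open>x \<noteq> 0\<close> by blast
    then show False using om x y n xy by blast
  qed
  show "x * y * z \<in> infinitesimals"
    if x: "x \<in> infinitesimals" and y: "y \<in> infinitesimals" and z: "z \<in> infinitesimals"
      and H: "x * y \<in> H" for x y z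
  proof (rule ccontr)
    assume n: "x * y * z \<notin> infinitesimals"
    note f = mult3_failure[OF sym om' x y z H n]
    have c: "c \<noteq> 0" "c \<notin> T" "\<And>b. b \<in> infinitesimals \<Longrightarrow> c * b \<in> infinitesimals"
      "\<And>b. b \<in> infinitesimals \<Longrightarrow> b / c \<in> infinitesimals" using c f(1) by auto
    \<comment> \<open>Since \<open>x * y \<in> T\<close> and \<open>c \<notin> T\<close>, the
      product \<open>x * (c * y)\<close> is not in \<open>T\<close>, so \<open>mult3_failure\<close>
      cannot occur for \<open>x\<close>, \<open>c * y\<close>, \<open>z\<close>.\<close>
    have "x * (c * y) * z \<in> infinitesimals"
    proof (cases "x * (c * y) \<in> H")
      case True
      show ?thesis
      proof (rule ccontr)
        assume "x * (c * y) * z \<notin> infinitesimals"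
        then have "x * (c * y) \<in> T" using mult3_failure(2)[OF sym om' x c(3)[OF y] z True] by blast
        then have "(x * y) * c \<in> T" by (simp add: ac_simps)
        then show False using T.mult_cancel f(2) c(2) by blast
      qed
    next
      case False
      then have 1: "x * (c * y) \<in> infinitesimals" using infinitesimals_mult x c(3)[OF y] by blast
      have "x * (c * y) * z \<notin> H"
      proof
        assume "x * (c * y) * z \<in> H"
        then have "(y * z) * (c * x) \<in> H" by (simp add: ac_simps)
        then have "c * x \<in> H" using f(3) T_sub H.mult_cancel by blast
        then show False using c(3)[OF x] infinitesimalsD by blast
      qed
      then show ?thesis using infinitesimals_mult 1 z by blast
    qed
    then have "x * (c * y) * z / c \<in> infinitesimals" using c by blast
    then show False using n c(1) by (simp add: ac_simps)
  qed
qed (fact sym)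

text \<open>
  Below, \<open>D e a\<close> says that \<open>e\<close> dominates \<open>a\<close>. The entries of the triple \<open>1 + h + k = 0\<close>, where
  \<open>k = - (1 + h)\<close>, dominate the same elements up to sign, so they behave like units of a valuation ring.
\<close>
lemma valuation_of_nonrigid:
  assumes h: "h \<in> H" "- h \<notin> T" "1 + h \<notin> T" "(1 + h) * h \<notin> T" "1 + h \<noteq> 0"
  shows "rigid_pair_valuation T H"
proof -
  have h0: "h \<noteq> 0" using h H.nonzero by blast
  \<comment> \<open>Otherwise \<open>h = (1 + h) + - 1\<close> would lie in the coset of
    \<open>1 + h\<close> or of \<open>- 1\<close>, against the hypotheses.\<close>
  have gH: "1 + h \<in> H"
  proof (rule ccontr)
    assume n: "1 + h \<notin> H"
    have "((1 + h) + (- 1)) * (1 + h) \<in> T \<or> ((1 + h) + (- 1)) * (- 1) \<in> T"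
    proof (rule sum_class)
      show "(1 + h) * (1 + h) \<in> T" using T.square_mem h(5) by blast
      show "- 1 * - 1 \<in> T" using T.one_mem by simp
      show "(1 + h) * - 1 \<notin> H" using n uminus_H_iff[of "1 + h"] by simp
    qed
    moreover have "(1 + h) + - 1 = h" by simp
    ultimately have "h * (1 + h) \<in> T \<or> - h \<in> T" by (metis mult_minus1_right)
    then show False using h by (simp add: mult.commute)
  qed
  define D where "D e a \<longleftrightarrow> (e + a) * e \<in> T" for e a
  have cross: "(e + a) * a \<in> T" if "\<not> D e a" "e \<in> H" "a \<notin> H" "a \<noteq> 0" for e a
    using sum_class[of e e a a] that T.square_mem H.mult_cancel[OF that(2)] H.nonzero
    unfolding D_def by blast
  have notboth: "\<not> ((e + a) * e \<in> T \<and> (e + a) * a \<in> T)" if "e \<in> H" "a \<notin> H" for e a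
    using T.same_class_trans[of e "e + a" a] that T_sub H.mult_cancel[OF that(1)]
    by (auto simp: mult.commute)
  \<comment> \<open>Domination passes from \<open>- g\<close> to \<open>e\<close>: if it did not,
    \<open>- g + a = f + (e + a)\<close> would lie in the coset of \<open>f\<close> or of
    \<open>a\<close>, although it lies in that of \<open>- g\<close>.\<close>
  have step: "D e a" if e: "e + f + g = 0" "e \<in> H" "f \<in> H" "g \<in> H" "- (f * g) \<notin> T"
    and a: "a \<notin> H" "a \<noteq> 0" and d: "D (- g) a" for e f g a
  proof (rule ccontr)
    assume n: "\<not> D e a"
    have fa: "f * a \<notin> H" using e a H.mult_cancel by auto
    have "(f + (e + a)) * f \<in> T \<or> (f + (e + a)) * a \<in> T"
      using sum_class[OF T.square_mem[OF H.nonzero[OF e(3)]] cross[OF n e(2) a] fa] .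
    moreover have "f + (e + a) = - g + a" using e(1) by (simp add: algebra_simps add_eq_0_iff)
    ultimately have "(- g + a) * f \<in> T \<or> (- g + a) * a \<in> T" by simp
    then show False
    proof
      assume "(- g + a) * f \<in> T"
      then have "f * (- g) \<in> T" using d T.same_class_trans[of f "- g + a" "- g"]
        by (simp add: D_def mult.commute)
      then show False using e(5) by simp
    next
      assume "(- g + a) * a \<in> T"
      then show False using d notboth[of "- g" a] e a uminus_H_iff unfolding D_def by blast
    qed
  qed
  have D_neg: "D (- e) (- a) \<longleftrightarrow> D e a" for e a
    by (simp add: D_def algebra_simps)
  have step': "D e a" if "e + f + g = 0" "e \<in> H" "f \<in> H" "g \<in> H" "- (f * g) \<notin> T"
    "a \<notin> H" "a \<noteq> 0" "D g (- a)" for e f g a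
    using step[OF that(1-7)] D_neg[of g "- a"] that(8) by simp
  define k where "k = - (1 + h)"
  have hg: "- (1 * h) \<notin> T" "- (h * k) \<notin> T" "- (1 * k) \<notin> T"
    "- (h * 1) \<notin> T" "- (k * h) \<notin> T" "- (k * 1) \<notin> T"
  proof -
    have "- (h * k) = (1 + h) * h" "- k = 1 + h" by (simp_all add: k_def algebra_simps)
    then show "- (1 * h) \<notin> T" "- (h * k) \<notin> T" "- (1 * k) \<notin> T"
      "- (h * 1) \<notin> T" "- (k * h) \<notin> T" "- (k * 1) \<notin> T"
      using h by (simp_all add: mult.commute)
  qed
  have gH': "k \<in> H" unfolding k_def using gH uminus_H_iff by blast
  have inf: "a / e \<in> infinitesimals \<longleftrightarrow> D e a" if "a \<noteq> 0" "a \<notin> H" "e \<in> H" for a e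
  proof -
    have "e \<noteq> 0" using that H.nonzero by blast
    have "a / e \<notin> H" using that H.divide_iff H.mult_cancel_right by blast
    moreover have "1 + a / e = (e + a) / e" using \<open>e \<noteq> 0\<close> by (simp add: field_simps)
    then have "1 + a / e \<in> T \<longleftrightarrow> D e a" unfolding D_def using T.divide_iff by metis
    ultimately show ?thesis using that \<open>e \<noteq> 0\<close> by (auto simp: infinitesimals_def)
  qed
  have sums: "1 + h + k = 0" "h + k + 1 = 0" "k + 1 + h = 0" "1 + k + h = 0" "h + 1 + k = 0" "k + h + 1 = 0"
    by (simp_all add: k_def)
  \<comment> \<open>Each use of \<open>step'\<close> changes the sign of \<open>a\<close>: two steps
    around the triple reach \<open>h\<close> and \<open>k\<close> with the sign restored, three
    return to \<open>1\<close> with the sign changed.\<close>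
  have eqv: "D 1 (- a)" "D h a" "D k a" if a: "a \<notin> H" "a \<noteq> 0" and d: "D 1 a" for a
  proof -
    have ma: "- a \<notin> H" "- a \<noteq> 0" using a uminus_H_iff by auto
    have 1: "D h (- a)"
      using step'[OF sums(2) h(1) gH' H.one_mem hg(6) ma] d by simp
    have 2: "D k (- a)"
      using step'[OF sums(6) gH' h(1) H.one_mem hg(4) ma] d by simp
    have 4: "D k a" using step'[OF sums(3) gH' H.one_mem h(1) hg(1) a] 1 by simp
    have 5: "D h a" using step'[OF sums(5) h(1) H.one_mem gH' hg(3) a] 2 by simp
    show "D h a" "D k a" using 4 5 by auto
    show "D 1 (- a)" using step'[OF sums(4) H.one_mem gH' h(1) hg(5) ma] 5 by simp
  qed
  have eqv': "D 1 a" if a: "a \<notin> H" "a \<noteq> 0" and d: "D h a" for a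
  proof -
    have ma: "- a \<notin> H" "- a \<noteq> 0" using a uminus_H_iff by auto
    have "D 1 (- a)" using step'[OF sums(4) H.one_mem gH' h(1) hg(5) ma] d by simp
    then show ?thesis using eqv(1)[OF ma] by simp
  qed
  have inf1: "a \<in> infinitesimals \<longleftrightarrow> D 1 a" if "a \<noteq> 0" "a \<notin> H" for a
    using inf[OF that H.one_mem] by simp
  show ?thesis
  proof (rule valuation_of_sym)
    show sym: "- x \<in> infinitesimals" if "x \<in> infinitesimals" for x
      using that infinitesimalsD[OF that] inf1 eqv(1)[of x] uminus_H_iff[of x] by auto
    have hb: "h * b \<in> infinitesimals" if b: "b \<in> infinitesimals" for b
    proof -
      have nb: "b \<noteq> 0" "b \<notin> H" "h * b \<noteq> 0" "h * b \<notin> H"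
        using infinitesimalsD[OF b] h0 H.mult_cancel[OF h(1)] by auto
      have "D h (h * b)" using inf[OF nb(3,4) h(1)] b h0 by simp
      then show ?thesis using eqv' inf1 nb by blast
    qed
    have bh: "b / h \<in> infinitesimals" if b: "b \<in> infinitesimals" for b
      using eqv(2) inf1 inf[OF _ _ h(1)] b infinitesimalsD(1,2)[OF b] by blast
    show "h \<noteq> 0 \<and> h \<notin> T \<and> (\<forall>b\<in>infinitesimals. h * b \<in> infinitesimals \<and> b / h \<in> infinitesimals)"
      if "- 1 \<in> T"
      using h0 h T.mult_cancel[OF that, of h] hb bh by auto
    fix x y assume x: "x \<in> infinitesimals" and y: "y \<in> infinitesimals" and m1: "- 1 \<in> T"
      and xy: "x * y \<in> T"
    have nb: "y \<noteq> 0" "y \<notin> H" "(1 + h) * y \<noteq> 0" "(1 + h) * y \<notin> H"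
      using infinitesimalsD[OF y] h H.mult_cancel[OF gH] by auto
    have "D (1 + h) ((1 + h) * y)" using inf[OF nb(3,4) gH] y h by simp
    then have "D 1 ((1 + h) * y)"
      using step[OF sums(1) H.one_mem h(1) gH' hg(2) nb(4,3)] by (simp add: k_def add.commute)
    then have gy: "(1 + h) * y \<in> infinitesimals" using inf1 nb by blast
    \<comment> \<open>The pair \<open>x\<close>, \<open>(1 + h) * y\<close> escapes the failure, as
      \<open>x * y \<in> T\<close> and \<open>1 + h \<notin> T\<close>. A failure for
      \<open>x\<close>, \<open>y\<close> would put the resulting element of \<open>T\<close> into
      the coset of \<open>- x\<close> or of \<open>h\<close>.\<close>
    have "x * ((1 + h) * y) \<notin> T"
    proof
      assume "x * ((1 + h) * y) \<in> T"
      then have "(x * y) * (1 + h) \<in> T" by (simp add: ac_simps)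
      then show False using T.mult_cancel[OF xy] h by blast
    qed
    then have tot: "1 - x * ((1 + h) * y) \<in> T"
      using one_minus_mult_failure(2)[OF x gy] by blast
    show "1 - x * y \<in> T"
    proof (rule ccontr)
      assume "1 - x * y \<notin> T"
      then have "(1 - x * y) * - x \<in> T" using one_minus_mult_failure(1) x y by blast
      moreover have "(- (h * (x * y))) * h \<in> T"
        using T.mult_mem[OF m1 T.mult_mem[OF T.square_mem[OF h0] xy]] by (simp add: ac_simps)
      moreover have "- x * h \<notin> H"
        using H.mult_cancel_right[OF h(1)] uminus_H_iff infinitesimalsD(2)[OF x] by blast
      ultimately have "((1 - x * y) + - (h * (x * y))) * - x \<in> T \<or>
          ((1 - x * y) + - (h * (x * y))) * h \<in> T"
        by (rule sum_class)
      moreover have "(1 - x * y) + - (h * (x * y)) = 1 - x * ((1 + h) * y)"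
        by (simp add: algebra_simps)
      ultimately have "- x \<in> T \<or> h \<in> T" using T.mult_cancel[OF tot] by metis
      then show False
        using T.mult_cancel[OF m1, of h] T.mult_cancel[OF m1, of x] h infinitesimalsD(3)[OF x] by simp
    qed
  qed
qed

end

text \<open>Enlarging \<open>H\<close> by the coset of \<open>a\<close> discards the infinitesimals
  in that coset; on those that remain, \<open>a\<close> is the element \<open>c\<close> asked for by
  \<open>valuation_of_sym\<close>.\<close>

locale rigid_pair_unit = rigid_pair +
  fixes a
  assumes a: "a \<in> infinitesimals"
    and unit: "\<lbrakk>b \<in> infinitesimals; b \<notin> H; b * a \<notin> H\<rbrakk>
      \<Longrightarrow> - b \<in> infinitesimals \<and> b * a \<in> infinitesimals \<and> b / a \<in> infinitesimals"
begin

definition H' where "H' = {x. x \<in> H \<or> x * a \<in> H}"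

lemma square_subgroup_H': "square_subgroup H'"
proof
  fix x y
  have "a \<noteq> 0" using a infinitesimalsD by blast
  then have 1: "x * y * a \<in> H" if "x * a \<in> H" "y \<in> H" for x y
    using H.mult_mem[OF that] by (simp add: ac_simps)
  have 2: "x * y \<in> H" if "x * a \<in> H" "y * a \<in> H" for x y
    using that H.same_class_trans[of x a y] by (simp add: mult.commute)
  show "x * y \<in> H'" if "x \<in> H'" "y \<in> H'"
    using that 1[of x y] 1[of y x] 2 H.mult_mem by (auto simp: H'_def mult.commute)
qed (use H.square_mem H.zero_notin in \<open>auto simp: H'_def\<close>)

sublocale ext: rigid_pair T H'
proof -
  interpret H': square_subgroup H' by (rule square_subgroup_H')
  show "rigid_pair T H'"
    by unfold_locales (use T_sub minus_one rigid_outside in \<open>auto simp: H'_def\<close>)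
qed

lemma ext_infinitesimals: "x \<in> ext.infinitesimals \<longleftrightarrow> x \<in> infinitesimals \<and> x * a \<notin> H"
  unfolding ext.infinitesimals_def infinitesimals_def by (auto simp: H'_def)

lemma ext_valuation: "rigid_pair_valuation T H'"
proof (rule ext.valuation_of_sym)
  have a0: "a \<noteq> 0" using a infinitesimalsD by blast
  have closed: "- b \<in> ext.infinitesimals \<and> a * b \<in> ext.infinitesimals \<and> b / a \<in> ext.infinitesimals"
    if "b \<in> ext.infinitesimals" for b
  proof -
    have b: "b \<in> infinitesimals" "b \<notin> H" "b * a \<notin> H"
      using that ext_infinitesimals infinitesimalsD by auto
    moreover have "b * a * a \<notin> H" using H.square_cancel[OF a0, of b] b by (simp add: ac_simps)
    ultimately show ?thesis
      using unit[OF b] uminus_H_iff[of "b * a"] a0 by (simp add: ext_infinitesimals mult.commute)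
  qed
  show "- x \<in> ext.infinitesimals" if "x \<in> ext.infinitesimals" for x using closed that by blast
  show "a \<noteq> 0 \<and> a \<notin> T \<and> (\<forall>b\<in>ext.infinitesimals. a * b \<in> ext.infinitesimals \<and> b / a \<in> ext.infinitesimals)"
    using closed a infinitesimalsD by blast
  fix x y assume "x \<in> ext.infinitesimals" "y \<in> ext.infinitesimals"
  then have x: "x \<in> infinitesimals" "x * a \<notin> H" "x \<notin> H" and y: "y \<in> infinitesimals"
    using ext_infinitesimals infinitesimalsD by auto
  \<comment> \<open>A failure would make \<open>a / x\<close> infinitesimal by
    \<open>one_minus_mult_failure_unit\<close>, whereas \<open>unit\<close> makes its inverse
    infinitesimal.\<close>
  show "1 - x * y \<in> T"
  proof (rule ccontr)
    assume "1 - x * y \<notin> T"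
    then have ax: "a / x \<in> infinitesimals"
      using one_minus_mult_failure_unit[OF x(1) y _ a] x by (simp add: mult.commute)
    have "x / a \<in> infinitesimals" using unit x by blast
    then have "inverse (a / x) \<in> infinitesimals" by simp
    then show False using ax inverse_infinitesimal_iff infinitesimalsD by blast
  qed
qed

end

context rigid_pair begin

text \<open>
  Any failure of the properties of \<^locale>\<open>rigid_pair_valuation\<close> is caused by an infinitesimal \<open>a\<close>
  that acts as a unit on all infinitesimals outside \<open>H \<union> aH\<close>.
\<close>
lemma valuation_or_unit:
  assumes "\<not> rigid_pair_valuation T H"
  obtains a where "rigid_pair_unit T H a"
proof -
  let ?S = "\<forall>x\<in>infinitesimals. - x \<in> infinitesimals"
  let ?O = "\<forall>x\<in>infinitesimals. \<forall>y\<in>infinitesimals. 1 - x * y \<in> T"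
  let ?M = "\<forall>x\<in>infinitesimals. \<forall>y\<in>infinitesimals. \<forall>z\<in>infinitesimals.
    x * y \<in> H \<longrightarrow> x * y * z \<in> infinitesimals"
  have "rigid_pair_valuation T H" if "?S" "?O" "?M"
    by unfold_locales (use that in blast)+
  then consider (sym) "\<not> ?S" | (om) "?S" "\<not> ?O" | (m3) "?S" "?O" "\<not> ?M"
    using assms by blast
  then show ?thesis
  proof cases
    case sym
    then obtain a where sym: "a \<in> infinitesimals" "- a \<notin> infinitesimals" by blast
    have a0: "a \<noteq> 0" "a \<notin> H" "- a \<notin> H" using sym infinitesimalsD uminus_H_iff by auto
    then have ia: "- inverse a \<in> infinitesimals" using sym inverse_infinitesimal_iff[of "- a"] by simp
    have "rigid_pair_unit T H a"
    proof unfold_locales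
      fix b assume b: "b \<in> infinitesimals" "b \<notin> H" "b * a \<notin> H"
      have nm: "b / a \<notin> H" "- (b / a) \<notin> H" "- b \<notin> H" "- (b * a) \<notin> H"
        using b H.divide_iff uminus_H_iff by auto
      \<comment> \<open>All these elements arise from \<open>b\<close> by successive multiplication
        with the infinitesimals \<open>a\<close> and \<open>- inverse a\<close>, in an order in
        which every product stays outside \<open>H\<close>.\<close>
      have 1: "b * a \<in> infinitesimals" using infinitesimals_mult b sym by blast
      have 2: "- (b / a) \<in> infinitesimals"
        using infinitesimals_mult[OF b(1) ia] nm by (simp add: divide_inverse)
      have 3: "- b \<in> infinitesimals" using infinitesimals_mult[OF 2 sym(1)] nm a0 by simp
      have 4: "b / a \<in> infinitesimals"
        using infinitesimals_mult[OF 3 ia] nm by (simp add: divide_inverse)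
      show "- b \<in> infinitesimals \<and> b * a \<in> infinitesimals \<and> b / a \<in> infinitesimals"
        using 1 3 4 by blast
    qed (fact sym)
    then show ?thesis by (rule that)
  next
    case om
    then obtain x y where xy: "x \<in> infinitesimals" "y \<in> infinitesimals" "1 - x * y \<notin> T" by blast
    have "rigid_pair_unit T H x"
      by unfold_locales
        (use om(1) xy one_minus_mult_failure_unit[OF xy] infinitesimals_mult in blast)+
    then show ?thesis by (rule that)
  next
    case m3
    then obtain x y z where xyz: "x \<in> infinitesimals" "y \<in> infinitesimals" "z \<in> infinitesimals"
      and xyH: "x * y \<in> H" and n: "x * y * z \<notin> infinitesimals"
      by blast
    have nz: "x \<noteq> 0" "y \<noteq> 0" "z \<noteq> 0" using xyz infinitesimalsD by auto
    note f = mult3_failure[OF bspec[OF m3(1)] bspec[OF bspec[OF m3(2)]] xyz xyH n]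
    have "rigid_pair_unit T H x"
    proof unfold_locales
      fix b assume b: "b \<in> infinitesimals" "b \<notin> H" "b * x \<notin> H"
      have bx: "b / x \<notin> H" using b H.divide_iff by simp
      have "y * b \<notin> H"
        using H.same_class_trans[of x y b] xyH b(3) by (auto simp: mult.commute)
      then have 1: "y * b \<in> infinitesimals" using infinitesimals_mult xyz b by blast
      have "z * (y * b) \<notin> H"
        using H.mult_cancel[of "y * z" b] f(3) T_sub b(2) by (auto simp: ac_simps)
      then have 2: "z * (y * b) \<in> infinitesimals" using infinitesimals_mult xyz 1 by blast
      \<comment> \<open>The failure made \<open>inverse (x * y * z)\<close> infinitesimal, which
        leads from \<open>z * (y * b)\<close> to \<open>b / x\<close>.\<close>
      have "inverse (x * y * z) * (z * (y * b)) = b / x" using nz by (simp add: field_simps)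
      then have "b / x \<in> infinitesimals" using infinitesimals_mult[OF f(4) 2] bx by simp
      then show "- b \<in> infinitesimals \<and> b * x \<in> infinitesimals \<and> b / x \<in> infinitesimals"
        using m3(1) xyz b infinitesimals_mult by blast
    qed (fact xyz)
    then show ?thesis by (rule that)
  qed
qed

end

lemma (in rigid_pair_valuation) ex_compatible:
  "\<exists>R. compatible T R \<and> ring_units R \<subseteq> H"
  using val_subring_rigid_ring one_plus_max_rigid_ring ring_units_rigid_ring
  unfolding compatible_def by blast

lemma (in rigid_pair) ex_compatible_almost:
  "\<exists>R a. compatible T R \<and> (\<forall>x\<in>ring_units R. x \<in> H \<or> x * a \<in> H)"
proof (cases "rigid_pair_valuation T H")
  case True
  then show ?thesis using rigid_pair_valuation.ex_compatible by blast
next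
  case False
  then obtain a where "rigid_pair_unit T H a" by (rule valuation_or_unit)
  then interpret u: rigid_pair_unit T H a .
  interpret v: rigid_pair_valuation T u.H' by (rule u.ext_valuation)
  show ?thesis using v.ex_compatible unfolding u.H'_def by blast
qed

section \<open>Comparison of valuation rings\<close>

definition one_unit_classes :: "'a::field set \<Rightarrow> 'a set" where
  "one_unit_classes R = {(1 + m) * (y * y) | m y. m \<in> R - ring_units R \<and> y \<noteq> 0}"

definition unit_classes :: "'a::field set \<Rightarrow> 'a set" where
  "unit_classes R = {u * (y * y) | u y. u \<in> ring_units R \<and> y \<noteq> 0}"

section \<open>Maximal ideal, unit classes and rigidity in a valuation ring\<close>

context val_subring begin

lemma minus_one_mem: "- 1 \<in> R"
  using inverse_mem[of "- 1"] by auto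

lemma unit_mult: "\<lbrakk>x \<in> ring_units R; y \<in> ring_units R\<rbrakk> \<Longrightarrow> x * y \<in> ring_units R"
  by (auto simp: ring_units_def mult_mem)

lemma unit_inverse: "x \<in> ring_units R \<Longrightarrow> inverse x \<in> ring_units R"
  by (auto simp: ring_units_def)

lemma minus_one_unit: "- 1 \<in> ring_units R"
  using minus_one_mem by (simp add: ring_units_def)

lemma one_unit: "1 \<in> ring_units R"
  using one_mem by (simp add: ring_units_def)

lemma max_mult:
  assumes "m \<in> R - ring_units R" "r \<in> R" shows "m * r \<in> R - ring_units R"
proof -
  have "m * r \<notin> ring_units R"
  proof
    assume "m * r \<in> ring_units R"
    then have "m \<noteq> 0" "r \<noteq> 0" "r * inverse (m * r) \<in> R"
      using mult_mem assms by (auto simp: ring_units_def)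
    then have "inverse m \<in> R" by (simp add: field_simps)
    then show False using assms \<open>m \<noteq> 0\<close> by (auto simp: ring_units_def)
  qed
  then show ?thesis using assms mult_mem by auto
qed

lemma max_add:
  assumes "x \<in> R - ring_units R" "y \<in> R - ring_units R" shows "x + y \<in> R - ring_units R"
proof (cases "x = 0 \<or> y = 0")
  case True then show ?thesis using assms by auto
next
  case False
  have *: "x + y \<in> R - ring_units R" if "x \<in> R - ring_units R" "x \<noteq> 0" "y / x \<in> R" for x y
  proof -
    have "x + y = x * (1 + y / x)" using that by (simp add: field_simps)
    then show ?thesis using max_mult[OF that(1)] add_mem one_mem that by metis
  qed
  have "y / x \<in> R \<or> x / y \<in> R" using inverse_mem[of "y / x"] by auto
  then show ?thesis using * assms False by (metis add.commute)
qed

lemma one_plus_max_unit: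
  assumes "m \<in> R - ring_units R" shows "1 + m \<in> ring_units R"
proof (rule ccontr)
  assume "1 + m \<notin> ring_units R"
  then have "1 + m \<in> R - ring_units R" using assms add_mem one_mem by blast
  moreover have "m * - 1 \<in> R - ring_units R" using max_mult assms minus_one_mem by blast
  ultimately have "(1 + m) + m * - 1 \<in> R - ring_units R" by (rule max_add)
  then show False using one_unit by simp
qed

lemma max_or_inverse_max:
  assumes "x \<noteq> 0" "x \<notin> ring_units R"
  shows "x \<in> R - ring_units R \<or> inverse x \<in> R - ring_units R"
  using assms inverse_mem[of x] unit_inverse[of "inverse x"] by auto

lemma inverse_max: "x \<notin> R \<Longrightarrow> inverse x \<in> R - ring_units R"
  using inverse_mem[of x] unit_inverse[of "inverse x"] by (auto simp: ring_units_def)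

lemma square_subgroup_unit_classes: "square_subgroup (unit_classes R)"
proof
  fix x y :: 'a
  show "x * x \<in> unit_classes R" if "x \<noteq> 0"
    unfolding unit_classes_def using that one_unit by force
  show "x * y \<in> unit_classes R" if x: "x \<in> unit_classes R" and y: "y \<in> unit_classes R"
  proof -
    obtain u a v b where "x = u * (a * a)" "u \<in> ring_units R" "a \<noteq> 0"
      "y = v * (b * b)" "v \<in> ring_units R" "b \<noteq> 0"
      using x y unfolding unit_classes_def by blast
    then have "x * y = (u * v) * ((a * b) * (a * b))" "u * v \<in> ring_units R" "a * b \<noteq> 0"
      using unit_mult by (auto simp: ac_simps)
    then show ?thesis unfolding unit_classes_def by blast
  qed
qed (auto simp: unit_classes_def ring_units_def)

lemma one_unit_classes_sub: "one_unit_classes R \<subseteq> unit_classes R"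
  unfolding one_unit_classes_def unit_classes_def using one_plus_max_unit by blast

lemma unit_in_unit_classes: "u \<in> ring_units R \<Longrightarrow> u \<in> unit_classes R"
  unfolding unit_classes_def by (force intro: exI[of _ 1])

lemma one_plus_in_one_unit_classes: "m \<in> R - ring_units R \<Longrightarrow> 1 + m \<in> one_unit_classes R"
  unfolding one_unit_classes_def by (force intro: exI[of _ 1])

lemma square_subgroup_one_unit_classes: "square_subgroup (one_unit_classes R)"
proof
  fix x y :: 'a
  have "0 \<in> R - ring_units R" using zero_mem by (auto simp: ring_units_def)
  then show "x * x \<in> one_unit_classes R" if "x \<noteq> 0"
    unfolding one_unit_classes_def using that by (force intro: exI[of _ 0])
  show "0 \<notin> one_unit_classes R"
    using one_unit_classes_sub square_subgroup.zero_notin[OF square_subgroup_unit_classes] by blast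
  show "x * y \<in> one_unit_classes R" if x: "x \<in> one_unit_classes R" and y: "y \<in> one_unit_classes R"
  proof -
    obtain m a n b where *: "x = (1 + m) * (a * a)" "m \<in> R - ring_units R" "a \<noteq> 0"
      "y = (1 + n) * (b * b)" "n \<in> R - ring_units R" "b \<noteq> 0"
      using x y unfolding one_unit_classes_def by blast
    then have "m + n + m * n \<in> R - ring_units R" by (intro max_add max_mult) auto
    moreover have "x * y = (1 + (m + n + m * n)) * ((a * b) * (a * b))"
      using * by (simp add: algebra_simps)
    ultimately show ?thesis unfolding one_unit_classes_def
      using * by (intro CollectI exI[of _ "m + n + m * n"] exI[of _ "a * b"]) auto
  qed
qed

text \<open>\<open>t * x / s\<close> is not a unit, so it or its inverse lies in the maximal ideal;
  accordingly \<open>s\<close> or \<open>t * x\<close> is factored out of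
  \<open>s + t * x\<close>.\<close>

lemma rigid_one_unit_classes:
  assumes x: "x \<noteq> 0" "x \<notin> unit_classes R" shows "rigid (one_unit_classes R) x"
proof -
  interpret T: square_subgroup "one_unit_classes R" by (rule square_subgroup_one_unit_classes)
  interpret U: square_subgroup "unit_classes R" by (rule square_subgroup_unit_classes)
  have "s + t * x \<in> one_unit_classes R \<union> {t * x |t. t \<in> one_unit_classes R}"
    if s: "s \<in> one_unit_classes R" and t: "t \<in> one_unit_classes R" for s t
  proof -
    have nz: "s \<noteq> 0" "t \<noteq> 0" using s t T.nonzero by auto
    have "s \<in> unit_classes R" "t \<in> unit_classes R" using s t one_unit_classes_sub by auto
    then have "t * x / s \<notin> unit_classes R"
      using x by (simp add: U.divide_iff U.mult_cancel U.mult_cancel_right del: times_divide_eq_left)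
    then have nu: "t * x / s \<notin> ring_units R" using unit_in_unit_classes by blast
    from max_or_inverse_max[OF _ nu] nz x
    consider "t * x / s \<in> R - ring_units R" | "s / (t * x) \<in> R - ring_units R" by auto
    then show ?thesis
    proof cases
      case 1
      have "s + t * x = s * (1 + t * x / s)" using nz by (simp add: field_simps)
      then show ?thesis using T.mult_mem s one_plus_in_one_unit_classes[OF 1] by auto
    next
      case 2
      have "s + t * x = (t * (1 + s / (t * x))) * x" using nz x by (simp add: field_simps)
      moreover have "t * (1 + s / (t * x)) \<in> one_unit_classes R"
        using T.mult_mem t one_plus_in_one_unit_classes[OF 2] by auto
      ultimately show ?thesis by blast
    qed
  qed
  then show ?thesis unfolding rigid_def by blast
qed

lemma basic_part_one_unit_classes: "basic_part (one_unit_classes R) \<subseteq> unit_classes R"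
proof -
  interpret U: square_subgroup "unit_classes R" by (rule square_subgroup_unit_classes)
  have "- x \<in> unit_classes R \<longleftrightarrow> x \<in> unit_classes R" for x
    using U.mult_cancel[OF unit_in_unit_classes[OF minus_one_unit], of x] by simp
  then show ?thesis
    using rigid_one_unit_classes unfolding basic_part_def by (auto, metis neg_equal_0_iff_equal)
qed

end

text \<open>
  Weak approximation: if \<open>c\<close> is in the maximal ideal of \<open>R'\<close> and \<open>1 / c\<close> in that of \<open>R\<close>, then
  \<open>(1 + x c) / (1 + c)\<close> is close to \<open>1\<close> for \<open>R'\<close> and to \<open>x\<close> for \<open>R\<close>.
\<close>
lemma incomparable_units_sub:
  assumes "val_subring R" "val_subring R'" "square_subgroup T"
    and T: "\<And>m. m \<in> R - ring_units R \<Longrightarrow> 1 + m \<in> T"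
    and T': "\<And>m. m \<in> R' - ring_units R' \<Longrightarrow> 1 + m \<in> T"
    and inc: "\<not> R \<subseteq> R'" "\<not> R' \<subseteq> R"
  shows "ring_units R \<subseteq> T"
proof -
  interpret R: val_subring R by fact
  interpret R': val_subring R' by fact
  interpret T: square_subgroup T by fact
  obtain a b where a: "a \<in> R" "a \<notin> R'" and b: "b \<in> R'" "b \<notin> R" using inc by blast
  have nz: "a \<noteq> 0" "b \<noteq> 0" using a b R.zero_mem R'.zero_mem by auto
  have c': "b / a \<in> R' - ring_units R'"
    using R'.max_mult[OF R'.inverse_max[OF a(2)] b(1)] by (simp add: field_simps)
  have c: "inverse (b / a) \<in> R - ring_units R"
    using R.max_mult[OF R.inverse_max[OF b(2)] a(1)] by (simp add: field_simps)
  have split: "z \<in> T" if "z \<noteq> 0" "1 + z \<in> T" "1 + inverse z \<in> T" for z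
  proof -
    have "1 + z = z * (1 + inverse z)" using that by (simp add: field_simps)
    then show ?thesis using that T.mult_cancel_right by metis
  qed
  have "b / a \<in> T" using split T[OF c] T'[OF c'] nz by simp
  \<comment> \<open>Both \<open>b / a\<close> and \<open>x * (b / a)\<close> lie in the maximal
    ideal of \<open>R'\<close> while their inverses lie in that of \<open>R\<close>, so
    \<open>split\<close> puts both into \<open>T\<close>, and with them \<open>x\<close>.\<close>
  moreover have "x * (b / a) \<in> T" if x: "x \<in> ring_units R" "x \<in> R'" for x
  proof (rule split)
    show "x * (b / a) \<noteq> 0" using x nz by (auto simp: ring_units_def)
    show "1 + x * (b / a) \<in> T" using T' R'.max_mult[OF c' x(2)] by (simp add: mult.commute)
    have "inverse (b / a) * inverse x \<in> R - ring_units R"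
      by (rule R.max_mult[OF c]) (use x in \<open>simp add: ring_units_def\<close>)
    then have "1 + inverse (b / a) * inverse x \<in> T" by (rule T)
    then show "1 + inverse (x * (b / a)) \<in> T" by (simp only: inverse_mult_distrib mult.commute)
  qed
  ultimately have *: "x \<in> T" if "x \<in> ring_units R" "x \<in> R'" for x
    using that T.mult_cancel_right by blast
  show ?thesis
  proof
    fix x assume x: "x \<in> ring_units R"
    then show "x \<in> T"
      using * R.unit_inverse[OF x] R'.inverse_mem[of x] T.inverse_iff by blast
  qed
qed

lemma (in val_subring) max_antimono:
  assumes "R \<subseteq> R'" shows "R' - ring_units R' \<subseteq> R - ring_units R"
proof
  fix x assume x: "x \<in> R' - ring_units R'"
  have "x \<in> R"
  proof (rule ccontr)
    assume n: "x \<notin> R"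
    then have "x \<noteq> 0" using zero_mem by auto
    then show False using x inverse_mem[OF n] assms by (auto simp: ring_units_def)
  qed
  then show "x \<in> R - ring_units R" using x assms by (auto simp: ring_units_def)
qed

section \<open>Two-divisible subgroups of finitely generated and of ordered abelian groups\<close>

lemma (in comm_group) generate_insert_decomp:
  assumes "x \<in> generate G (insert s S)" "s \<in> carrier G" "S \<subseteq> carrier G"
  shows "\<exists>k::int. \<exists>g\<in>generate G S. x = s [^] k \<otimes> g"
  using assms(1)
proof induction
  case one
  show ?case using generate.one by (intro exI[of _ 0] bexI[of _ \<one>]) auto
next
  case (incl h)
  show ?case
  proof (cases "h = s")
    case True
    then show ?thesis using assms generate.one by (intro exI[of _ 1] bexI[of _ \<one>]) auto
  next
    case False
    then show ?thesis using incl assms generate.incl[of h S G] by (intro exI[of _ 0] bexI[of _ h]) auto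
  qed
next
  case (inv h)
  show ?case
  proof (cases "h = s")
    case True
    then show ?thesis using assms generate.one
      by (intro exI[of _ "- 1"] bexI[of _ \<one>]) (auto simp: int_pow_neg)
  next
    case False
    then show ?thesis using inv assms generate.inv[of h S G] by (intro exI[of _ 0] bexI[of _ "inv h"]) auto
  qed
next
  case (eng h1 h2)
  then obtain k1 g1 k2 g2 where *: "g1 \<in> generate G S" "g2 \<in> generate G S"
    "h1 = s [^] (k1::int) \<otimes> g1" "h2 = s [^] (k2::int) \<otimes> g2" by blast
  then have c: "g1 \<in> carrier G" "g2 \<in> carrier G" using generate_in_carrier assms by blast+
  have "h1 \<otimes> h2 = s [^] (k1 + k2) \<otimes> (g1 \<otimes> g2)"
    using * c assms by (simp add: int_pow_mult m_ac)
  then show ?case using generate.eng[OF *(1,2)] by (intro exI bexI)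
qed

text \<open>
  The argument is that of Nakayama's lemma: an odd multiple of a 2-divisible group needs one
  generator less.
\<close>
lemma (in comm_group) two_divisible_subgroup_torsion:
  assumes "finite S" "S \<subseteq> carrier G" "subgroup D G" "D \<subseteq> generate G S"
    and "\<And>d. d \<in> D \<Longrightarrow> \<exists>e\<in>D. d = e \<otimes> e"
  shows "\<exists>m::nat. odd m \<and> (\<forall>d\<in>D. d [^] m = \<one>)"
  using assms
proof (induction S arbitrary: D rule: finite_induct)
  case empty
  then show ?case using generate_empty by (intro exI[of _ 1]) auto
next
  case (insert s S)
  have s: "s \<in> carrier G" "S \<subseteq> carrier G" using insert.prems by auto
  interpret E: subgroup "generate G S" G using generate_is_subgroup s by blast
  interpret D: subgroup D G by fact
  \<comment> \<open>The exponents with which \<open>s\<close> occurs in \<open>D\<close>, modulo the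
    subgroup generated by \<open>S\<close>, form an ideal of the integers; the number
    \<open>j\<close> below is its positive generator.\<close>
  define P where "P j \<longleftrightarrow> (\<exists>d\<in>D. \<exists>g\<in>generate G S. d = s [^] j \<otimes> g)" for j :: int
  have P_I: "P j" if "d \<in> D" "g \<in> generate G S" "d = s [^] j \<otimes> g" for d g j
    using that unfolding P_def by blast
  have P_E: "\<exists>d g. d \<in> D \<and> g \<in> generate G S \<and> d = s [^] j \<otimes> g" if "P j" for j
    using that unfolding P_def by blast
  have decomp: "\<exists>k::int. \<exists>g. g \<in> generate G S \<and> d = s [^] k \<otimes> g" if "d \<in> D" for d
    using generate_insert_decomp[of d s S] insert.prems(3) s that by blast
  show ?case
  proof (cases "\<exists>j. j \<noteq> 0 \<and> P j")
    case False
    have "D \<subseteq> generate G S"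
    proof
      fix d assume d: "d \<in> D"
      then obtain k :: int and g where g: "g \<in> generate G S" "d = s [^] k \<otimes> g" using decomp by blast
      then have "k = 0" using False P_I[OF d] by blast
      then show "d \<in> generate G S" using g by simp
    qed
    then show ?thesis using insert.IH[OF s(2) insert.prems(2)] insert.prems(4) by blast
  next
    case True
    have neg: "P (- j)" if P: "P j" for j
    proof -
      obtain d g where *: "d \<in> D" "g \<in> generate G S" "d = s [^] j \<otimes> g" using P_E[OF P] by blast
      then have "inv d \<in> D" "inv g \<in> generate G S" by auto
      moreover have "inv d = s [^] (- j) \<otimes> inv g"
        using * s by (simp add: int_pow_neg inv_mult)
      ultimately show ?thesis by (rule P_I)
    qed
    have lin: "P (i - q * j)" if P: "P i" "P j" for i j q
    proof -
      obtain d g where d: "d \<in> D" "g \<in> generate G S" "d = s [^] i \<otimes> g" using P_E[OF P(1)] by blast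
      obtain e h where e: "e \<in> D" "h \<in> generate G S" "e = s [^] j \<otimes> h" using P_E[OF P(2)] by blast
      have "s [^] (i - q * j) = s [^] i \<otimes> s [^] (- (j * q))"
        using int_pow_mult[OF s(1), of i "- (j * q)"] by (simp add: mult.commute)
      then have eq: "d \<otimes> e [^] (- q) = s [^] (i - q * j) \<otimes> (g \<otimes> h [^] (- q))"
        using d e s by (simp add: int_pow_distrib int_pow_pow m_ac)
      have "e [^] (- q) \<in> D" "h [^] (- q) \<in> generate G S"
        using subgroup_int_pow_closed[OF D.subgroup_axioms e(1)]
          subgroup_int_pow_closed[OF E.subgroup_axioms e(2)] by blast+
      then show ?thesis using P_I[OF _ _ eq] d e by blast
    qed
    define j where "j = (LEAST n::nat. n > 0 \<and> P (int n))"
    obtain j0 where j0: "j0 \<noteq> 0" "P j0" using True by blast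
    then have "nat \<bar>j0\<bar> > 0 \<and> P (int (nat \<bar>j0\<bar>))" using neg[of j0] by (cases "j0 > 0") auto
    then have j: "j > 0" "P (int j)"
      using LeastI[of "\<lambda>n. n > 0 \<and> P (int n)"] unfolding j_def by blast+
    have min: "\<not> P (int n)" if "n < j" "n \<noteq> 0" for n
      using that not_less_Least[of n "\<lambda>n. n > 0 \<and> P (int n)"] unfolding j_def by blast
    have least: "int j dvd i" if "P i" for i :: int
    proof -
      have "P (i - (i div int j) * int j)" by (rule lin[OF that j(2)])
      then have "P (int (nat (i mod int j)))" using j(1) by (simp add: minus_div_mult_eq_mod)
      moreover have "nat (i mod int j) < j" using j(1) by (simp add: nat_less_iff)
      ultimately have "nat (i mod int j) = 0" using min by blast
      moreover have "i mod int j \<ge> 0" using j(1) by simp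
      ultimately show ?thesis by (simp add: dvd_eq_mod_eq_0)
    qed
    obtain d0 g0 where d0: "d0 \<in> D" "g0 \<in> generate G S" "d0 = s [^] int j \<otimes> g0"
      using P_E[OF j(2)] by blast
    obtain e where e: "e \<in> D" "d0 = e \<otimes> e" using insert.prems(4) d0 by blast
    obtain i :: int and h where h: "h \<in> generate G S" "e = s [^] i \<otimes> h"
      using decomp[OF e(1)] by blast
    obtain l where l: "i = int j * l" using least[OF P_I[OF e(1) h]] by blast
    \<comment> \<open>Comparing the exponents \<open>j\<close> and \<open>2 * i = 2 * j * l\<close>
      in \<open>d0 = e \<otimes> e\<close> shows that the power of \<open>s\<close> with exponent
      \<open>j * (1 - 2 * l)\<close> lies in the subgroup generated by \<open>S\<close>. The factor
      \<open>1 - 2 * l\<close> is odd.\<close>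
    have "s [^] int j \<otimes> g0 = s [^] (2 * i) \<otimes> (h \<otimes> h)"
      using d0 e h s int_pow_mult[OF s(1), of i i] by (simp add: m_ac)
    then have "s [^] (- (2 * i)) \<otimes> (s [^] int j \<otimes> g0) =
        s [^] (- (2 * i)) \<otimes> (s [^] (2 * i) \<otimes> (h \<otimes> h))" by simp
    moreover have "s [^] (- (2 * i)) \<otimes> s [^] (2 * i) = \<one>"
      using int_pow_mult[OF s(1), of "- (2 * i)" "2 * i"] by simp
    moreover have "s [^] (- (2 * i)) \<otimes> s [^] int j = s [^] (int j - 2 * i)"
      using int_pow_mult[OF s(1), of "- (2 * i)" "int j"] by simp
    ultimately have "s [^] (int j - 2 * i) \<otimes> g0 = h \<otimes> h"
      using s d0(2) h(1) by (simp flip: m_assoc)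
    then have "s [^] (int j - 2 * i) = h \<otimes> h \<otimes> inv g0"
      using s d0(2) h(1) by (simp add: inv_solve_right)
    then have sE: "s [^] (int j * (1 - 2 * l)) \<in> generate G S"
      using d0 h l by (simp add: algebra_simps)
    define a where "a = nat \<bar>1 - 2 * l\<bar>"
    have odd_a: "odd a" by (simp add: a_def even_nat_iff)
    have sa: "s [^] (int j * int a) \<in> generate G S"
    proof (cases "1 - 2 * l \<ge> 0")
      case True then show ?thesis using sE by (simp add: a_def)
    next
      case False
      then have "int j * int a = - (int j * (1 - 2 * l))" by (simp add: a_def algebra_simps)
      then show ?thesis using sE s by (simp add: int_pow_neg)
    qed
    \<comment> \<open>The exponents of \<open>s\<close> in \<open>D\<close> are multiples of
      \<open>j\<close>, so raising to the power \<open>a\<close> makes them multiples of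
      \<open>j * a\<close>, and \<open>s\<close> disappears.\<close>
    define D' where "D' = (\<lambda>d. d [^] a) ` D"
    have "subgroup D' G"
    proof (rule subgroupI)
      show "inv x \<in> D'" if "x \<in> D'" for x
        using that by (auto simp: D'_def nat_pow_inv[symmetric])
      show "x \<otimes> y \<in> D'" if xy: "x \<in> D'" "y \<in> D'" for x y
      proof -
        obtain b c where "b \<in> D" "c \<in> D" "x = b [^] a" "y = c [^] a"
          using xy unfolding D'_def by blast
        then have "b \<otimes> c \<in> D" "x \<otimes> y = (b \<otimes> c) [^] a" by (auto simp: nat_pow_distrib)
        then show ?thesis unfolding D'_def by blast
      qed
      show "D' \<noteq> {}" unfolding D'_def using D.one_closed by blast
    qed (auto simp: D'_def)
    moreover have "D' \<subseteq> generate G S"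
    proof
      fix x assume "x \<in> D'"
      then obtain d where d: "d \<in> D" "x = d [^] a" by (auto simp: D'_def)
      obtain k :: int and g where g: "g \<in> generate G S" "d = s [^] k \<otimes> g"
        using decomp[OF d(1)] by blast
      obtain q where q: "k = int j * q" using least[OF P_I[OF d(1) g]] by blast
      have "x = d [^] int a" using d by (simp add: int_pow_int)
      also have "\<dots> = s [^] (k * int a) \<otimes> g [^] int a"
        using g s by (simp add: int_pow_distrib int_pow_pow)
      also have "s [^] (k * int a) = (s [^] (int j * int a)) [^] q"
        using s q by (simp add: int_pow_pow ac_simps)
      finally have "x = (s [^] (int j * int a)) [^] q \<otimes> g [^] int a" .
      then show "x \<in> generate G S"
        using subgroup_int_pow_closed[OF E.subgroup_axioms] sa g by simp
    qed
    moreover have "\<exists>e\<in>D'. d = e \<otimes> e" if d: "d \<in> D'" for d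
    proof -
      obtain c where c: "c \<in> D" "d = c [^] a" using d by (auto simp: D'_def)
      then obtain b where b: "b \<in> D" "c = b \<otimes> b" using insert.prems(4) by blast
      then have "d = b [^] a \<otimes> b [^] a" using c by (simp add: nat_pow_distrib)
      then show ?thesis using b by (auto simp: D'_def)
    qed
    ultimately obtain m :: nat where m: "odd m" "\<forall>d\<in>D'. d [^] m = \<one>"
      using insert.IH s by blast
    have "d [^] (a * m) = \<one>" if "d \<in> D" for d
      using m that by (auto simp: D'_def nat_pow_pow)
    then show ?thesis using odd_a m by (intro exI[of _ "a * m"]) auto
  qed
qed

text \<open>Ordered groups are torsion-free: on either side of the identity, positive powers of
  \<open>a\<close> lie at least as far away as \<open>a\<close>.\<close>

lemma (in linordered_abelian_group) pow_eq_one: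
  assumes a: "a \<in> carrier G" and n: "a [^] n = \<one>" "n > (0::nat)"
  shows "a = \<one>"
proof -
  obtain m where m: "n = Suc m" using n by (cases n) auto
  have up: "gle G a (a [^] Suc m)" if "gle G \<one> a" for m
  proof (induction m)
    case 0 then show ?case using a gle_refl by simp
  next
    case (Suc m)
    have "gle G (\<one> \<otimes> a [^] Suc m) (a \<otimes> a [^] Suc m)"
      using gle_mult_mono[of \<one> a] that a by blast
    then have "gle G (a [^] Suc m) (a [^] Suc (Suc m))" using a by (simp add: m_ac)
    then show ?case using Suc gle_trans a by (meson nat_pow_closed)
  qed
  have down: "gle G (a [^] Suc m) a" if "gle G a \<one>" for m
  proof (induction m)
    case 0 then show ?case using a gle_refl by simp
  next
    case (Suc m)
    have "gle G (a \<otimes> a [^] Suc m) (\<one> \<otimes> a [^] Suc m)"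
      using gle_mult_mono[of a \<one>] that a by blast
    then have "gle G (a [^] Suc (Suc m)) (a [^] Suc m)" using a by (simp add: m_ac)
    then show ?case using Suc gle_trans a by (meson nat_pow_closed)
  qed
  show ?thesis
    using gle_linear[OF a one_closed] up[of m] down[of m] gle_antisym[OF a one_closed] n m by auto
qed

section \<open>Valuations with prescribed valuation ring\<close>

lemma (in square_subgroup) mem_coset_iff: "x \<noteq> 0 \<Longrightarrow> y \<in> {t * x |t. t \<in> S} \<longleftrightarrow> y * x \<in> S"
proof
  assume "x \<noteq> 0" "y * x \<in> S"
  then show "y \<in> {t * x |t. t \<in> S}" by (intro CollectI exI[of _ "y / x"]) (simp add: divide_iff)
next
  assume x: "x \<noteq> 0" and "y \<in> {t * x |t. t \<in> S}"
  then obtain t where "t \<in> S" "y = t * x" by blast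
  then show "y * x \<in> S" using mult_mem[OF _ square_mem[OF x], of t] by (simp add: mult.assoc)
qed

lemma (in square_subgroup) rigid_iff:
  assumes "x \<noteq> 0"
  shows "rigid S x \<longleftrightarrow> (\<forall>s\<in>S. \<forall>t\<in>S. s + t * x \<in> S \<or> (s + t * x) * x \<in> S)"
proof -
  have "rigid S x \<longleftrightarrow> (\<forall>s\<in>S. \<forall>t\<in>S. s + t * x \<in> S \<or> s + t * x \<in> {t * x |t. t \<in> S})"
    unfolding rigid_def by blast
  then show ?thesis unfolding mem_coset_iff[OF assms] .
qed

text \<open>The sum \<open>x + 1 * - x\<close> is \<open>0\<close>, which lies in no coset of
  \<open>S\<close>.\<close>

lemma (in square_subgroup) not_rigid_uminus:
  assumes x: "x \<in> S" shows "\<not> rigid S (- x)"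
proof
  assume "rigid S (- x)"
  then have "x + 1 * - x \<in> S \<or> (x + 1 * - x) * - x \<in> S"
    using rigid_iff[of "- x"] nonzero[OF x] x one_mem by (metis neg_equal_0_iff_equal)
  then show False using zero_notin by simp
qed

lemma (in square_subgroup) sub_basic_part: "S \<union> uminus ` S \<subseteq> basic_part S"
  using not_rigid_uminus nonzero unfolding basic_part_def by force

lemma rigid_pair_basic_part:
  assumes "square_subgroup T" "square_subgroup H" "basic_part T \<subseteq> H"
  shows "rigid_pair T H"
proof -
  interpret T: square_subgroup T by fact
  interpret H: square_subgroup H by fact
  show ?thesis
  proof
    show "T \<subseteq> H" "- 1 \<in> H" using T.sub_basic_part assms(3) T.one_mem by auto
    fix x :: 'a assume x: "x \<noteq> 0" "x \<notin> H"
    then have "rigid T x" using assms(3) unfolding basic_part_def by blast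
    then show "1 + x \<in> T \<or> (1 + x) * x \<in> T" using T.rigid_iff[OF x(1)] T.one_mem by force
  qed
qed

lemma ex_compatible_unexceptional:
  assumes "square_subgroup T" "square_subgroup H" "basic_part T \<subseteq> H" "\<not> exceptional T"
  shows "\<exists>R. compatible T R \<and> ring_units R \<subseteq> H"
proof -
  interpret rigid_pair T H by (rule rigid_pair_basic_part) fact+
  obtain y s t where y: "y \<in> H" "- y \<notin> T" and st: "s \<in> T" "t \<in> T"
    "s + t * y \<notin> T" "(s + t * y) * y \<notin> T"
  proof (cases "basic_part T = T \<union> uminus ` T")
    case True
    then obtain s t where "- 1 \<notin> T" "s \<in> T" "t \<in> T" "s + t \<notin> T"
      using assms(4) unfolding exceptional_def by blast
    then show ?thesis using that[of 1 s t] T.one_mem H.one_mem by simp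
  next
    case False
    then obtain x where x: "x \<in> basic_part T" "x \<notin> T" "- x \<notin> T"
      using T.sub_basic_part by force
    then have x0: "x \<noteq> 0" "- x \<noteq> 0" and xH: "x \<in> H" "- x \<in> H"
      using assms(3) uminus_H_iff unfolding basic_part_def by auto
    from x(1) have "\<not> rigid T x \<or> \<not> rigid T (- x)" unfolding basic_part_def by blast
    then show ?thesis
    proof
      assume "\<not> rigid T x"
      then show ?thesis using that[of x] xH x unfolding T.rigid_iff[OF x0(1)] by blast
    next
      assume "\<not> rigid T (- x)"
      then show ?thesis using that[of "- x"] xH x unfolding T.rigid_iff[OF x0(2)] by auto
    qed
  qed
  \<comment> \<open>Dividing \<open>s + t * y\<close> by \<open>s\<close> normalises it to
    \<open>1 + h\<close>, where \<open>h\<close> stays in the coset of \<open>y\<close>.\<close>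
  define h where "h = t * y / s"
  have nz: "s \<noteq> 0" "t \<noteq> 0" "y \<noteq> 0" using st y T.nonzero H.nonzero by auto
  have 1: "1 + h = (s + t * y) / s" unfolding h_def using nz by (simp add: field_simps)
  have hH: "h \<in> H"
    unfolding h_def H.divide_iff using H.mult_mem st(1,2) y(1) T_sub by blast
  have "- h = (t * - y) / s" unfolding h_def by simp
  then have hT: "- h \<notin> T"
    using T.divide_iff[of "t * - y" s] T.mult_cancel_right[OF st(1)] T.mult_cancel[OF st(2)] y(2) by metis
  have h1: "1 + h \<notin> T" unfolding 1 T.divide_iff T.mult_cancel_right[OF st(1)] by fact
  have "(1 + h) * h = (s + t * y) * (t * y) / (s * s)"
    unfolding 1 h_def using nz by (simp add: field_simps)
  then have "(1 + h) * h \<in> T \<longleftrightarrow> (s + t * y) * (t * y) \<in> T"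
    by (simp only: T.divide_iff T.mult_cancel_right[OF T.square_mem[OF nz(1)]])
  moreover have "(s + t * y) * (t * y) = t * ((s + t * y) * y)" by (simp only: ac_simps)
  ultimately have "(1 + h) * h \<in> T \<longleftrightarrow> t * ((s + t * y) * y) \<in> T" by metis
  then have h2: "(1 + h) * h \<notin> T" using T.mult_cancel[OF st(2)] st(4) by simp
  have h0: "1 + h \<noteq> 0"
  proof
    assume "1 + h = 0"
    then have "- h = 1" by (metis add_eq_0_iff minus_minus)
    then show False using hT T.one_mem by simp
  qed
  interpret rigid_pair_valuation T H
    by (rule valuation_of_nonrigid[OF hH hT h1 h2 h0])
  show ?thesis by (rule ex_compatible)
qed

lemma ex_compatible_basic_part:
  assumes "square_subgroup T" "square_subgroup H" "basic_part T \<subseteq> H"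
  shows "\<exists>R a. compatible T R \<and> (\<forall>x\<in>ring_units R. x \<in> H \<or> x * a \<in> H)"
  by (rule rigid_pair.ex_compatible_almost[OF rigid_pair_basic_part[OF assms]])

section \<open>The valuation belonging to a valuation ring\<close>

definition unit_coset :: "'a::field set \<Rightarrow> 'a \<Rightarrow> 'a set" where
  "unit_coset R x = (\<lambda>u. x * u) ` ring_units R"

text \<open>This is the multiplicative group modulo the units. Its elements are sets of field
  elements, so the type of the value group is determined by the field.\<close>

definition ring_value_group :: "'a::field set \<Rightarrow> 'a set ordered_monoid" where
  "ring_value_group R = \<lparr>carrier = unit_coset R ` (UNIV - {0}),
     mult = (\<lambda>A B. {a * b | a b. a \<in> A \<and> b \<in> B}), one = ring_units R,
     gle = (\<lambda>A B. \<exists>a\<in>A. \<exists>b\<in>B. b / a \<in> R)\<rparr>"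

context val_subring begin

lemma unit_coset_eq_iff:
  assumes "x \<noteq> 0" "y \<noteq> 0" shows "unit_coset R x = unit_coset R y \<longleftrightarrow> y / x \<in> ring_units R"
proof
  assume "unit_coset R x = unit_coset R y"
  moreover have "y \<in> unit_coset R y" unfolding unit_coset_def using one_unit by force
  ultimately obtain u where "u \<in> ring_units R" "y = x * u" unfolding unit_coset_def by blast
  then show "y / x \<in> ring_units R" using assms by simp
next
  have sub: "unit_coset R y \<subseteq> unit_coset R x" if xy: "y / x \<in> ring_units R" "x \<noteq> 0" for x y
  proof
    fix z assume "z \<in> unit_coset R y"
    then obtain u where u: "u \<in> ring_units R" "z = y * u" unfolding unit_coset_def by blast
    then have "z = x * (y / x * u)" using xy by simp
    then show "z \<in> unit_coset R x" unfolding unit_coset_def using unit_mult xy u by blast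
  qed
  assume yx: "y / x \<in> ring_units R"
  then have "x / y \<in> ring_units R" using unit_inverse[OF yx] by simp
  then show "unit_coset R x = unit_coset R y" using sub yx assms by blast
qed

lemma unit_coset_mult:
  "{a * b | a b. a \<in> unit_coset R x \<and> b \<in> unit_coset R y} = unit_coset R (x * y)"
proof
  show "{a * b | a b. a \<in> unit_coset R x \<and> b \<in> unit_coset R y} \<subseteq> unit_coset R (x * y)"
    unfolding unit_coset_def using unit_mult by (fastforce simp: ac_simps)
  show "unit_coset R (x * y) \<subseteq> {a * b | a b. a \<in> unit_coset R x \<and> b \<in> unit_coset R y}"
  proof
    fix z assume "z \<in> unit_coset R (x * y)"
    then obtain u where "u \<in> ring_units R" "z = (x * u) * (y * 1)"
      unfolding unit_coset_def by (auto simp: ac_simps)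
    then show "z \<in> {a * b | a b. a \<in> unit_coset R x \<and> b \<in> unit_coset R y}"
      unfolding unit_coset_def using one_unit by blast
  qed
qed

lemma unit_coset_le_iff:
  assumes "x \<noteq> 0" "y \<noteq> 0"
  shows "(\<exists>a\<in>unit_coset R x. \<exists>b\<in>unit_coset R y. b / a \<in> R) \<longleftrightarrow> y / x \<in> R"
proof
  assume "\<exists>a\<in>unit_coset R x. \<exists>b\<in>unit_coset R y. b / a \<in> R"
  then obtain u v where uv: "u \<in> ring_units R" "v \<in> ring_units R" "(y * v) / (x * u) \<in> R"
    unfolding unit_coset_def by blast
  then have "u * inverse v \<in> R" "u \<noteq> 0" "v \<noteq> 0"
    using mult_mem by (auto simp: ring_units_def)
  then have "(y * v) / (x * u) * (u * inverse v) \<in> R" using mult_mem uv(3) by blast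
  moreover have "(y * v) / (x * u) * (u * inverse v) = y / x"
    using \<open>u \<noteq> 0\<close> \<open>v \<noteq> 0\<close> by (simp add: field_simps)
  ultimately show "y / x \<in> R" by metis
next
  assume "y / x \<in> R"
  moreover have "x \<in> unit_coset R x" "y \<in> unit_coset R y"
    unfolding unit_coset_def using one_unit by force+
  ultimately show "\<exists>a\<in>unit_coset R x. \<exists>b\<in>unit_coset R y. b / a \<in> R" by blast
qed

lemma unit_coset_one: "unit_coset R 1 = ring_units R"
  by (simp add: unit_coset_def)

lemma field_valuation_unit_coset: "field_valuation (ring_value_group R) (unit_coset R)"
proof -
  let ?G = "ring_value_group R"
  have simps: "mult ?G (unit_coset R x) (unit_coset R y) = unit_coset R (x * y)"
    "one ?G = unit_coset R 1" for x y
    by (simp_all add: ring_value_group_def unit_coset_mult unit_coset_one)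
  have le: "gle ?G (unit_coset R x) (unit_coset R y) \<longleftrightarrow> y / x \<in> R" if "x \<noteq> 0" "y \<noteq> 0" for x y
    using unit_coset_le_iff[OF that] by (simp add: ring_value_group_def)
  have car: "carrier ?G = unit_coset R ` (UNIV - {0})" by (simp add: ring_value_group_def)
  have memI: "unit_coset R x \<in> carrier ?G" if "x \<noteq> 0" for x using that car by auto
  have memE: "\<exists>x. x \<noteq> 0 \<and> A = unit_coset R x" if "A \<in> carrier ?G" for A using that car by auto
  have "comm_group ?G"
  proof (rule comm_groupI)
    fix A B C assume A: "A \<in> carrier ?G" and B: "B \<in> carrier ?G" and C: "C \<in> carrier ?G"
    obtain x y z where "A = unit_coset R x" "B = unit_coset R y" "C = unit_coset R z"
      "x \<noteq> 0" "y \<noteq> 0" using memE[OF A] memE[OF B] memE[OF C] by blast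
    then show "A \<otimes>\<^bsub>?G\<^esub> B \<in> carrier ?G" "A \<otimes>\<^bsub>?G\<^esub> B \<otimes>\<^bsub>?G\<^esub> C = A \<otimes>\<^bsub>?G\<^esub> (B \<otimes>\<^bsub>?G\<^esub> C)"
      "A \<otimes>\<^bsub>?G\<^esub> B = B \<otimes>\<^bsub>?G\<^esub> A" "\<one>\<^bsub>?G\<^esub> \<otimes>\<^bsub>?G\<^esub> A = A"
      using memI[of "x * y"] by (simp_all add: simps ac_simps)
  next
    show "\<one>\<^bsub>?G\<^esub> \<in> carrier ?G" unfolding simps by (rule memI) simp
    fix A assume A: "A \<in> carrier ?G"
    obtain x where "A = unit_coset R x" "x \<noteq> 0" using memE[OF A] by blast
    then show "\<exists>B\<in>carrier ?G. B \<otimes>\<^bsub>?G\<^esub> A = \<one>\<^bsub>?G\<^esub>"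
      using memI[of "inverse x"] by (intro bexI[of _ "unit_coset R (inverse x)"]) (simp_all add: simps)
  qed
  then interpret G: comm_group ?G .
  show ?thesis
  proof
    fix A B C assume A: "A \<in> carrier ?G"
    obtain x where x: "A = unit_coset R x" "x \<noteq> 0" using memE[OF A] by blast
    show "gle ?G A A" using x le one_mem by simp
    assume B: "B \<in> carrier ?G"
    obtain y where y: "B = unit_coset R y" "y \<noteq> 0" using memE[OF B] by blast
    show "gle ?G A B \<or> gle ?G B A" using x y le inverse_mem[of "y / x"] by auto
    show "A = B" if "gle ?G A B" "gle ?G B A"
      using that x y le unit_coset_eq_iff[of x y] by (simp add: ring_units_def)
    assume C: "C \<in> carrier ?G"
    obtain z where z: "C = unit_coset R z" "z \<noteq> 0" using memE[OF C] by blast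
    show "gle ?G (A \<otimes>\<^bsub>?G\<^esub> C) (B \<otimes>\<^bsub>?G\<^esub> C)" if "gle ?G A B"
      using that x y z by (simp add: simps le)
    show "gle ?G A C" if "gle ?G A B" "gle ?G B C"
      using that x y z mult_mem[of "y / x" "z / y"] by (simp add: le)
  next
    show "unit_coset R \<in> hom mult_group ?G"
      using memI by (auto simp: hom_def mult_group_def simps)
    fix x y :: 'a assume "x \<noteq> 0" "y \<noteq> 0" "x + y \<noteq> 0"
    moreover have "(x + y) / x \<in> R \<or> (x + y) / y \<in> R"
    proof -
      have "y / x \<in> R \<or> x / y \<in> R" using inverse_mem[of "y / x"] by auto
      then have "1 + y / x \<in> R \<or> 1 + x / y \<in> R" using add_mem one_mem by blast
      moreover have "1 + y / x = (x + y) / x" "1 + x / y = (x + y) / y"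
        using \<open>x \<noteq> 0\<close> \<open>y \<noteq> 0\<close> by (simp_all add: field_simps)
      ultimately show ?thesis by metis
    qed
    ultimately show "gle ?G (unit_coset R x) (unit_coset R (x + y)) \<or>
        gle ?G (unit_coset R y) (unit_coset R (x + y))"
      by (simp add: le)
  qed
qed

lemma val_ring_unit_coset: "val_ring (ring_value_group R) (unit_coset R) = R"
proof -
  have "gle (ring_value_group R) (one (ring_value_group R)) (unit_coset R x) \<longleftrightarrow> x \<in> R" if "x \<noteq> 0" for x
    using unit_coset_le_iff[of 1 x] that by (simp add: ring_value_group_def unit_coset_one)
  then have "x = 0 \<or> gle (ring_value_group R) (one (ring_value_group R)) (unit_coset R x) \<longleftrightarrow> x \<in> R" for x
    using zero_mem by (cases "x = 0") auto
  then show ?thesis by (simp add: val_ring_def)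
qed

end

section \<open>The valuation ring of a valuation\<close>

lemma val_units_eq: "val_units G v = ring_units (val_ring G v)"
proof -
  have "y = inverse x" if "x * y = 1" for x y :: 'a using inverse_unique[OF that] by simp
  then show ?thesis unfolding val_units_def ring_units_def by (fastforce intro: right_inverse)
qed

lemma set_mult_nonzero_squares:
  "A <#>\<^bsub>mult_group\<^esub> nonzero_squares = {a * (y * y) | a y. a \<in> A \<and> y \<noteq> 0}"
  unfolding set_mult_def nonzero_squares_def mult_group_def by (auto simp: power2_eq_square)

lemma one_units_squares_eq: "one_units_squares G v = one_unit_classes (val_ring G v)"
  unfolding one_units_squares_def one_unit_classes_def set_mult_nonzero_squares val_max_def val_units_eq
  by blast

lemma units_squares_eq: "units_squares G v = unit_classes (val_ring G v)"
  unfolding units_squares_def unit_classes_def set_mult_nonzero_squares val_units_eq by blast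

context field_valuation begin

lemma val_inverse: "x \<noteq> 0 \<Longrightarrow> v x \<otimes> v (inverse x) = \<one>"
  using val_mult[of x "inverse x"] val_one by simp

lemma val_subring_val_ring: "val_subring (val_ring G v)"
proof
  show "0 \<in> val_ring G v" "1 \<in> val_ring G v" by (auto simp: val_ring_def val_one gle_refl)
  fix x y :: 'a
  show "x * y \<in> val_ring G v" if "x \<in> val_ring G v" "y \<in> val_ring G v"
  proof (cases "x = 0 \<or> y = 0")
    case True then show ?thesis by (auto simp: val_ring_def)
  next
    case False
    then have c: "v x \<in> carrier G" "v y \<in> carrier G" using val_closed by auto
    have le: "gle G \<one> (v x)" "gle G \<one> (v y)" using that False by (auto simp: val_ring_def)
    have "gle G (\<one> \<otimes> v y) (v x \<otimes> v y)" using gle_mult_mono le c by blast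
    then have "gle G \<one> (v x \<otimes> v y)" using gle_trans le c by (metis l_one m_closed one_closed)
    then show ?thesis using False by (simp add: val_ring_def val_mult)
  qed
  show "x + y \<in> val_ring G v" if "x \<in> val_ring G v" "y \<in> val_ring G v"
  proof (cases "x = 0 \<or> y = 0 \<or> x + y = 0")
    case True then show ?thesis using that by (auto simp: val_ring_def)
  next
    case False
    then have c: "v x \<in> carrier G" "v y \<in> carrier G" "v (x + y) \<in> carrier G" using val_closed by auto
    have "gle G \<one> (v x)" "gle G \<one> (v y)" using that False by (auto simp: val_ring_def)
    then show ?thesis using val_add[of x y] False gle_trans c one_closed unfolding val_ring_def by blast
  qed
  show "inverse x \<in> val_ring G v" if "x \<notin> val_ring G v"
  proof -
    have x: "x \<noteq> 0" "\<not> gle G \<one> (v x)" using that by (auto simp: val_ring_def)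
    then have c: "v x \<in> carrier G" "v (inverse x) \<in> carrier G" using val_closed by auto
    then have "gle G (v x) \<one>" using x gle_linear one_closed by blast
    then have "gle G (v x \<otimes> v (inverse x)) (\<one> \<otimes> v (inverse x))" using gle_mult_mono c one_closed by blast
    then show ?thesis using val_inverse x c by (simp add: val_ring_def)
  qed
qed

text \<open>
  If all units of a coarser ring had even value, its convex subgroup of values of units would be
  2-divisible, hence trivial.
\<close>
lemma coarser_unit:
  assumes fg: "finitely_generated_subgroup G (value_group v)"
    and R: "val_subring R" "val_ring G v \<subseteq> R" "\<not> R \<subseteq> val_ring G v"
  shows "\<exists>x\<in>ring_units R. x \<notin> unit_classes (val_ring G v)"
proof (rule ccontr)
  assume "\<not> ?thesis"
  then have all: "x \<in> unit_classes (val_ring G v)" if "x \<in> ring_units R" for x using that by blast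
  interpret R: val_subring R by fact
  interpret V: val_subring "val_ring G v" by (rule val_subring_val_ring)
  let ?D = "v ` ring_units R"
  have nz: "x \<noteq> 0" if "x \<in> ring_units R" for x using that by (simp add: ring_units_def)
  obtain S where S: "finite S" "S \<subseteq> value_group v" "generate G S = value_group v"
    using fg unfolding finitely_generated_subgroup_def by blast
  have vg: "value_group v \<subseteq> carrier G" using val_closed by (auto simp: value_group_def mult_group_def)
  have "subgroup ?D G"
  proof (rule subgroupI)
    show "?D \<subseteq> carrier G" using nz val_closed by auto
    show "?D \<noteq> {}" using R.one_unit by blast
    show "inv a \<in> ?D" if a: "a \<in> ?D" for a
    proof -
      obtain x where x: "x \<in> ring_units R" "a = v x" using a by blast
      then have "inv a = v (inverse x)"
        using val_inverse[OF nz[OF x(1)]] val_closed nz[OF x(1)] by (intro inv_equality) (auto simp: m_comm)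
      then show ?thesis using R.unit_inverse x by blast
    qed
    show "a \<otimes> b \<in> ?D" if ab: "a \<in> ?D" "b \<in> ?D" for a b
    proof -
      obtain x y where "x \<in> ring_units R" "a = v x" "y \<in> ring_units R" "b = v y" using ab by blast
      then have "a \<otimes> b = v (x * y)" "x * y \<in> ring_units R" using val_mult nz R.unit_mult by auto
      then show ?thesis by blast
    qed
  qed
  moreover have "?D \<subseteq> generate G S"
    unfolding S(3) value_group_def using nz by (auto simp: mult_group_def)
  moreover have "\<exists>e\<in>?D. d = e \<otimes> e" if d: "d \<in> ?D" for d
  proof -
    obtain x where x: "x \<in> ring_units R" "d = v x" using d by blast
    obtain u y where u: "u \<in> ring_units (val_ring G v)" "y \<noteq> 0" "x = u * (y * y)"
      using all[OF x(1)] unfolding unit_classes_def by blast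
    have "u \<noteq> 0" "v u = \<one>" using u val_units_iff unfolding val_units_eq by blast+
    then have vx: "d = v y \<otimes> v y" using u x val_mult val_closed by simp
    have "u \<in> ring_units R" using u R(2) by (auto simp: ring_units_def)
    then have "x * inverse u \<in> ring_units R" using R.unit_mult R.unit_inverse x by blast
    moreover have "x * inverse u = y * y" using u \<open>u \<noteq> 0\<close> by simp
    ultimately have yy: "y * y \<in> ring_units R" by metis
    \<comment> \<open>It is not enough that \<open>d\<close> is twice a value: the half
      \<open>v y\<close> must lie in \<open>?D\<close>. It does, because the maximal ideal of
      \<open>R\<close> cannot contain \<open>y\<close> or its inverse when \<open>y * y\<close> is a
      unit.\<close>
    have "y \<in> ring_units R"
    proof (rule ccontr)
      assume "y \<notin> ring_units R"
      then consider "y \<in> R - ring_units R" | "inverse y \<in> R - ring_units R"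
        using R.max_or_inverse_max u by blast
      then show False
      proof cases
        case 1
        then show False using R.max_mult[OF 1, of y] yy by blast
      next
        case 2
        then have "inverse y * inverse y \<in> R - ring_units R" using R.max_mult by blast
        then show False using R.unit_inverse[OF yy] by simp
      qed
    qed
    then show ?thesis using vx by blast
  qed
  ultimately obtain m :: nat where m: "odd m" "\<forall>d\<in>?D. d [^] m = \<one>"
    using two_divisible_subgroup_torsion[of S ?D] S vg by blast
  \<comment> \<open>Such an \<open>x\<close> is a unit of \<open>R\<close>, as its inverse lies in
    the smaller ring. Its value is torsion, hence trivial, which would put \<open>x\<close> into the
    smaller ring too.\<close>
  obtain x where x: "x \<in> R" "x \<notin> val_ring G v" using R(3) by blast
  then have "x \<noteq> 0" "inverse x \<in> R" using V.inverse_mem R(2) V.zero_mem by auto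
  then have xu: "x \<in> ring_units R" using x by (simp add: ring_units_def)
  then have "v x [^] m = \<one>" using m by blast
  then have "v x = \<one>" using pow_eq_one[of "v x" m] m(1) val_closed \<open>x \<noteq> 0\<close> by (cases m) auto
  then show False using x gle_refl by (simp add: val_ring_def)
qed

end

section \<open>Excluding a proper subgroup of the one-unit classes\<close>

lemma square_subgroup_pm:
  assumes "square_subgroup S" shows "square_subgroup (S \<union> uminus ` S)"
proof -
  interpret square_subgroup S by fact
  show ?thesis
  proof
    fix x y assume "x \<in> S \<union> uminus ` S" "y \<in> S \<union> uminus ` S"
    then have "(x \<in> S \<or> - x \<in> S) \<and> (y \<in> S \<or> - y \<in> S)" by auto
    then have "x * y \<in> S \<or> - (x * y) \<in> S"
      using mult_mem[of x y] mult_mem[of "- x" y] mult_mem[of x "- y"] mult_mem[of "- x" "- y"] by auto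
    then show "x * y \<in> S \<union> uminus ` S" by (metis UnI1 UnI2 image_eqI minus_minus)
  qed (use square_mem zero_notin in auto)
qed

lemma (in field_valuation) one_unit_classes_sub:
  fixes T U :: "'a set"
  defines "T \<equiv> one_unit_classes (val_ring G v)" and "U \<equiv> unit_classes (val_ring G v)"
  assumes fg: "finitely_generated_subgroup G (value_group v)"
    and S: "square_subgroup S" "S \<subseteq> T" and V: "square_subgroup V" "basic_part S \<subseteq> V"
    and hyp: "basic_part T = U \<and> \<not> exceptional T \<and> V \<subseteq> U \<or>
      basic_part T = T \<and> U \<noteq> T \<and> (\<forall>x\<in>V. x \<in> T \<or> x * g \<in> T)"
  shows "T \<subseteq> S"
proof -
  interpret R: val_subring "val_ring G v" by (rule val_subring_val_ring)
  interpret T: square_subgroup T unfolding T_def by (rule R.square_subgroup_one_unit_classes)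
  interpret U: square_subgroup U unfolding U_def by (rule R.square_subgroup_unit_classes)
  interpret S: square_subgroup S by fact
  interpret V: square_subgroup V by fact
  have TU: "T \<subseteq> U" unfolding T_def U_def by (rule R.one_unit_classes_sub)
  have uU: "ring_units (val_ring G v) \<subseteq> U" unfolding U_def using R.unit_in_unit_classes by blast
  have U_sub: "U \<subseteq> W" if W: "square_subgroup W" "ring_units (val_ring G v) \<subseteq> W" for W
    unfolding U_def unit_classes_def
    using square_subgroup.mult_mem[OF W(1)] square_subgroup.square_mem[OF W(1)] W(2) by blast
  have T_sub: "T \<subseteq> S" if "\<And>m. m \<in> val_ring G v - ring_units (val_ring G v) \<Longrightarrow> 1 + m \<in> S"
    unfolding T_def one_unit_classes_def using that S.mult_mem S.square_mem by blast
  have pmT: "T \<union> uminus ` T \<subseteq> basic_part T" by (rule T.sub_basic_part)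
  \<comment> \<open>In the first case of \<open>hyp\<close>, \<open>U = T\<close> would give
    \<open>basic_part T = T\<close> and \<open>- 1 \<in> T\<close>, so \<open>T\<close> would be
    exceptional; the second case states \<open>U \<noteq> T\<close>.\<close>
  have nUT: "\<not> U \<subseteq> T"
  proof
    assume "U \<subseteq> T"
    then have UT: "U = T" using TU by blast
    then have b: "basic_part T = T" and ex: "\<not> exceptional T" using hyp by auto
    have "- 1 \<in> T" "basic_part T = T \<union> uminus ` T" using pmT b T.one_mem by auto
    then show False using ex unfolding exceptional_def by blast
  qed
  have cmp: "T \<subseteq> S \<or> (ring_units (val_ring G v) \<subseteq> ring_units R \<and> (\<exists>x\<in>ring_units R. x \<notin> U))"
    if R: "compatible S R" for R
  proof -
    have "val_subring R" using R unfolding compatible_def by blast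
    then interpret R': val_subring R .
    consider "R \<subseteq> val_ring G v" | "val_ring G v \<subseteq> R" "\<not> R \<subseteq> val_ring G v"
      | "\<not> val_ring G v \<subseteq> R" "\<not> R \<subseteq> val_ring G v" by blast
    then show ?thesis
    proof cases
      case 1
      then show ?thesis using R'.max_antimono[OF 1] T_sub R unfolding compatible_def by blast
    next
      case 2
      have "ring_units (val_ring G v) \<subseteq> ring_units R" using 2(1) by (auto simp: ring_units_def)
      then show ?thesis using coarser_unit[OF fg R'.val_subring_axioms 2] unfolding U_def by blast
    next
      case 3
      have "1 + m \<in> T" if "m \<in> val_ring G v - ring_units (val_ring G v)" for m
        unfolding T_def by (rule R.one_plus_in_one_unit_classes[OF that])
      moreover have "1 + m \<in> T" if "m \<in> R - ring_units R" for m
        using that R S(2) unfolding compatible_def by blast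
      ultimately have "ring_units (val_ring G v) \<subseteq> T"
        using incomparable_units_sub[OF R.val_subring_axioms R'.val_subring_axioms T.square_subgroup_axioms]
          3 by blast
      then show ?thesis using U_sub[OF T.square_subgroup_axioms] nUT by blast
    qed
  qed
  show ?thesis
  proof (cases "exceptional S")
    case False
    obtain R where R: "compatible S R" "ring_units R \<subseteq> V"
      using ex_compatible_unexceptional[OF S(1) V False] by blast
    show ?thesis
    proof (rule ccontr)
      assume "\<not> ?thesis"
      then obtain x where x: "x \<in> ring_units R" "x \<notin> U"
        and sub: "ring_units (val_ring G v) \<subseteq> ring_units R" using cmp[OF R(1)] by blast
      then have n: "\<not> V \<subseteq> U" using R by blast
      then have g: "\<forall>x\<in>V. x \<in> T \<or> x * g \<in> T" using hyp by blast
      obtain u where u: "u \<in> ring_units (val_ring G v)" "u \<notin> T"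
        using U_sub[OF T.square_subgroup_axioms] nUT by blast
      \<comment> \<open>The units \<open>u \<notin> T\<close> and \<open>x \<notin> U\<close> both
        fall into the coset of \<open>g\<close>, so \<open>x\<close> differs from \<open>u\<close>
        by an element of \<open>T\<close> and would belong to \<open>U\<close>.\<close>
      then have "u * g \<in> T" using g sub R(2) by blast
      moreover have "x * g \<in> T" using g x R(2) TU by blast
      ultimately have "u * x \<in> T" using T.same_class_trans[of u g x] by (simp add: mult.commute)
      then show False using U.mult_cancel[of u x] TU uU u(1) x(2) by blast
    qed
  next
    case True
    then have b: "basic_part S = S \<union> uminus ` S" unfolding exceptional_def by blast
    define P where "P = S \<union> uminus ` S"
    interpret P: square_subgroup P unfolding P_def by (rule square_subgroup_pm) fact
    have PT: "P \<subseteq> T \<union> uminus ` T" unfolding P_def using S(2) by blast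
    have "- 1 \<in> U" using R.minus_one_unit uU by blast
    then have "- t \<in> U" if "t \<in> T" for t using U.mult_mem[of "- 1" t] that TU by auto
    then have PU: "P \<subseteq> U" using PT TU by blast
    obtain R a where R: "compatible S R" "\<And>x. x \<in> ring_units R \<Longrightarrow> x \<in> P \<or> x * a \<in> P"
      using ex_compatible_basic_part[OF S(1) P.square_subgroup_axioms] b unfolding P_def by blast
    show ?thesis
    proof (rule ccontr)
      assume n: "\<not> ?thesis"
      then obtain x where x: "x \<in> ring_units R" "x \<notin> U"
        and sub: "ring_units (val_ring G v) \<subseteq> ring_units R" using cmp[OF R(1)] by blast
      have xa: "x * a \<in> P" using R(2)[OF x(1)] x(2) PU by blast
      \<comment> \<open>A unit of \<open>v\<close> outside \<open>P\<close> would share the coset of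
        \<open>a\<close> with \<open>x\<close> and force \<open>x \<in> U\<close>. Hence
        \<open>U \<subseteq> P\<close>, which is incompatible with either case of
        \<open>hyp\<close>.\<close>
      have "u \<in> P" if u: "u \<in> ring_units (val_ring G v)" for u
      proof (rule ccontr)
        assume "u \<notin> P"
        then have "u * a \<in> P" using R(2) u sub by blast
        then have "u * x \<in> P" using P.same_class_trans[of u a x] xa by (simp add: mult.commute)
        then show False using U.mult_cancel[of u x] PU uU u x(2) by blast
      qed
      then have UP: "U \<subseteq> P" using U_sub[OF P.square_subgroup_axioms] by blast
      from hyp show False
      proof
        assume i: "basic_part T = U \<and> \<not> exceptional T \<and> V \<subseteq> U"
        obtain t where t: "t \<in> T" "t \<notin> S" using n by blast
        then have "t \<in> uminus ` S" using TU UP unfolding P_def by blast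
        then have "- t \<in> T" using S(2) by auto
        then have "- 1 \<in> T" using T.mult_cancel[OF t(1), of "- 1"] by simp
        moreover have "basic_part T = T \<union> uminus ` T" using i pmT UP PT by blast
        ultimately show False using i unfolding exceptional_def by blast
      next
        assume "basic_part T = T \<and> U \<noteq> T \<and> (\<forall>x\<in>V. x \<in> T \<or> x * g \<in> T)"
        then show False using UP PT pmT nUT by blast
      qed
    qed
  qed
qed

section \<open>Transport along a hyperfield isomorphism\<close>

definition corr_image :: "('a \<Rightarrow> 'b \<Rightarrow> bool) \<Rightarrow> 'a set \<Rightarrow> 'b set" where
  "corr_image C S = {y. \<exists>x\<in>S. C x y}"

lemma corr_image_mono: "S \<subseteq> S' \<Longrightarrow> corr_image C S \<subseteq> corr_image C S'"
  unfolding corr_image_def by blast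

text \<open>
  A hyperfield isomorphism, seen as a relation between field elements. The axioms are symmetric in
  the two fields.
\<close>
locale class_correspondence =
  fixes C :: "'a::field \<Rightarrow> 'b::field \<Rightarrow> bool"
  assumes corr_nonzero: "C x y \<Longrightarrow> x \<noteq> 0 \<and> y \<noteq> 0"
    and left_total: "x \<noteq> 0 \<Longrightarrow> \<exists>y. C x y"
    and right_total: "y \<noteq> 0 \<Longrightarrow> \<exists>x. C x y"
    and left_unique: "\<lbrakk>C x y; C x' y\<rbrakk> \<Longrightarrow> \<exists>z. z \<noteq> 0 \<and> x' = x * (z * z)"
    and right_unique: "\<lbrakk>C x y; C x y'\<rbrakk> \<Longrightarrow> \<exists>z. z \<noteq> 0 \<and> y' = y * (z * z)"
    and corr_one: "C 1 1"
    and corr_mult: "\<lbrakk>C x y; C x' y'\<rbrakk> \<Longrightarrow> C (x * x') (y * y')"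
    and corr_uminus: "C x y \<Longrightarrow> C (- x) (- y)"
    and corr_add: "\<lbrakk>C s s'; C t t'; \<And>z. z \<noteq> 0 \<Longrightarrow> t' \<noteq> - s' * (z * z)\<rbrakk> \<Longrightarrow>
      \<exists>c. C c (s' + t') \<and> (c = s \<or> c = t \<or> (\<exists>a b. a \<noteq> 0 \<and> b \<noteq> 0 \<and> c = s * (a * a) + t * (b * b)))"
    and corr_add_converse: "\<lbrakk>C s s'; C t t'; \<And>z. z \<noteq> 0 \<Longrightarrow> t \<noteq> - s * (z * z)\<rbrakk> \<Longrightarrow>
      \<exists>c. C (s + t) c \<and> (c = s' \<or> c = t' \<or> (\<exists>a b. a \<noteq> 0 \<and> b \<noteq> 0 \<and> c = s' * (a * a) + t' * (b * b)))"
begin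

lemma converse: "class_correspondence (\<lambda>y x. C x y)"
proof
  fix s t s' t'
  assume C: "C s s'" "C t t'"
  show "\<exists>c. C c (s' + t') \<and> (c = s \<or> c = t \<or> (\<exists>a b. a \<noteq> 0 \<and> b \<noteq> 0 \<and> c = s * (a * a) + t * (b * b)))"
    if "\<And>z. z \<noteq> 0 \<Longrightarrow> t' \<noteq> - s' * (z * z)"
    by (rule corr_add[OF C that])
  show "\<exists>c. C (s + t) c \<and> (c = s' \<or> c = t' \<or> (\<exists>a b. a \<noteq> 0 \<and> b \<noteq> 0 \<and> c = s' * (a * a) + t' * (b * b)))"
    if "\<And>z. z \<noteq> 0 \<Longrightarrow> t \<noteq> - s * (z * z)"
    by (rule corr_add_converse[OF C that])
qed (use corr_nonzero in blast, (rule left_total right_total left_unique right_unique corr_one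
    corr_mult corr_uminus; assumption)+)

lemma corr_image_iff:
  assumes "square_subgroup S" "C x y" shows "y \<in> corr_image C S \<longleftrightarrow> x \<in> S"
proof
  interpret square_subgroup S by fact
  assume "y \<in> corr_image C S"
  then obtain x' where "x' \<in> S" "C x' y" unfolding corr_image_def by blast
  then show "x \<in> S" using left_unique[of x' y x] assms(2) mult_mem square_mem by blast
qed (use assms in \<open>auto simp: corr_image_def\<close>)

lemma square_subgroup_corr_image:
  assumes "square_subgroup S" shows "square_subgroup (corr_image C S)"
proof -
  interpret square_subgroup S by fact
  show ?thesis
  proof
    fix x y :: 'b
    show "x * x \<in> corr_image C S" if "x \<noteq> 0"
    proof -
      obtain w where "C w x" using right_total \<open>x \<noteq> 0\<close> by blast
      then show ?thesis using corr_mult[of w x w x] corr_nonzero square_mem[of w]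
        unfolding corr_image_def by blast
    qed
    show "x * y \<in> corr_image C S" if "x \<in> corr_image C S" "y \<in> corr_image C S"
      using that corr_mult mult_mem unfolding corr_image_def by blast
    show "0 \<notin> corr_image C S" using corr_nonzero unfolding corr_image_def by blast
  qed
qed

lemma corr_image_converse:
  assumes "square_subgroup S" shows "corr_image (\<lambda>y x. C x y) (corr_image C S) = S"
proof
  show "corr_image (\<lambda>y x. C x y) (corr_image C S) \<subseteq> S"
    using corr_image_iff[OF assms] by (auto simp: corr_image_def[of "\<lambda>y x. C x y"])
  show "S \<subseteq> corr_image (\<lambda>y x. C x y) (corr_image C S)"
    using left_total square_subgroup.nonzero[OF assms] unfolding corr_image_def by blast
qed

lemma uminus_corr_image: "uminus ` corr_image C S = corr_image C (uminus ` S)"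
proof
  show "uminus ` corr_image C S \<subseteq> corr_image C (uminus ` S)"
    using corr_uminus unfolding corr_image_def by blast
  show "corr_image C (uminus ` S) \<subseteq> uminus ` corr_image C S"
  proof
    fix y assume "y \<in> corr_image C (uminus ` S)"
    then obtain x where "x \<in> S" "C (- x) y" unfolding corr_image_def by blast
    then have "- y \<in> corr_image C S" using corr_uminus[of "- x" y] unfolding corr_image_def by auto
    then show "y \<in> uminus ` corr_image C S" by force
  qed
qed

text \<open>The class of \<open>s' + t' * y\<close> lies in a hyperfield sum, so it corresponds to
  that of \<open>s\<close>, of \<open>t * x\<close>, or of a combination of the two with square
  coefficients; rigidity of \<open>x\<close> handles the last. Opposite classes, for which
  \<open>corr_add\<close> is silent, would mean \<open>- x \<in> S\<close>, contrary to
  \<open>not_rigid_uminus\<close>.\<close>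

lemma rigid_corr_image:
  assumes S: "square_subgroup S" and xy: "C x y" and r: "rigid S x"
  shows "rigid (corr_image C S) y"
proof -
  interpret square_subgroup S by fact
  interpret I: square_subgroup "corr_image C S" by (rule square_subgroup_corr_image) fact
  have nz: "x \<noteq> 0" "y \<noteq> 0" using corr_nonzero xy by auto
  have "s' + t' * y \<in> corr_image C S \<or> (s' + t' * y) * y \<in> corr_image C S"
    if s': "s' \<in> corr_image C S" and t': "t' \<in> corr_image C S" for s' t'
  proof -
    obtain s t where s: "s \<in> S" "C s s'" and t: "t \<in> S" "C t t'"
      using s' t' unfolding corr_image_def by blast
    have tx: "C (t * x) (t' * y)" using corr_mult t xy by blast
    have "t' * y \<noteq> - s' * (z * z)" if "z \<noteq> 0" for z
    proof
      assume eq: "t' * y = - s' * (z * z)"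
      have "(t' * y) * - s' = (s' * s') * (z * z)" unfolding eq by simp
      then have "(t' * y) * - s' \<in> corr_image C S"
        using I.mult_mem I.square_mem that s' I.nonzero by simp
      moreover have "C ((t * x) * - s) ((t' * y) * - s')" using corr_mult corr_uminus tx s by blast
      ultimately have "(t * x) * - s \<in> S" using corr_image_iff[OF S] by blast
      then have "(t * s) * - x \<in> S" by (simp add: ac_simps)
      then have "- x \<in> S" using mult_cancel[OF mult_mem[OF t(1) s(1)]] by blast
      then show False using not_rigid_uminus r by force
    qed
    then obtain c where c: "C c (s' + t' * y)" and
      "c = s \<or> c = t * x \<or> (\<exists>a b. a \<noteq> 0 \<and> b \<noteq> 0 \<and> c = s * (a * a) + t * x * (b * b))"
      using corr_add[OF s(2) tx] by blast
    then consider "c = s" | "c = t * x" | a b where "a \<noteq> 0" "b \<noteq> 0" "c = s * (a * a) + (t * (b * b)) * x"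
      by (auto simp: ac_simps)
    then have "c \<in> S \<or> c * x \<in> S"
    proof cases
      case 2
      then show ?thesis using t mult_mem square_mem nz by (simp add: mult.assoc)
    next
      case 3
      then show ?thesis using r s t mult_mem square_mem unfolding rigid_iff[OF nz(1)] by simp
    qed (use s in simp)
    moreover have "C (c * x) ((s' + t' * y) * y)" using corr_mult c xy by blast
    ultimately show ?thesis using corr_image_iff[OF S] c by blast
  qed
  then show ?thesis unfolding I.rigid_iff[OF nz(2)] by blast
qed

lemma rigid_corr_image_iff:
  assumes S: "square_subgroup S" and xy: "C x y"
  shows "rigid (corr_image C S) y \<longleftrightarrow> rigid S x"
proof
  interpret conv: class_correspondence "\<lambda>y x. C x y" by (rule converse)
  assume "rigid (corr_image C S) y"
  then show "rigid S x"
    using conv.rigid_corr_image[OF square_subgroup_corr_image[OF S] xy] corr_image_converse[OF S] by simp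
qed (rule rigid_corr_image[OF S xy])

lemma basic_part_corr_image:
  assumes S: "square_subgroup S"
  shows "basic_part (corr_image C S) = corr_image C (basic_part S)"
proof -
  have iff: "y \<in> basic_part (corr_image C S) \<longleftrightarrow> x \<in> basic_part S" if xy: "C x y" for x y
    using rigid_corr_image_iff[OF S xy] rigid_corr_image_iff[OF S corr_uminus[OF xy]] corr_nonzero[OF xy]
    unfolding basic_part_def by blast
  show ?thesis
  proof
    show "basic_part (corr_image C S) \<subseteq> corr_image C (basic_part S)"
    proof
      fix y assume y: "y \<in> basic_part (corr_image C S)"
      then obtain x where "C x y" using right_total unfolding basic_part_def by blast
      then show "y \<in> corr_image C (basic_part S)" using iff y unfolding corr_image_def by blast
    qed
    show "corr_image C (basic_part S) \<subseteq> basic_part (corr_image C S)"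
      using iff by (auto simp: corr_image_def[of C "basic_part S"])
  qed
qed

text \<open>Additive closure is transported when \<open>- 1 \<notin> S\<close>, since then two
  elements of the image never have opposite classes and \<open>corr_add\<close> applies; when
  \<open>- 1 \<in> S\<close>, the other alternative of exceptionality is transported.\<close>

lemma exceptional_corr_image:
  assumes S: "square_subgroup S" and e: "exceptional S"
  shows "exceptional (corr_image C S)"
proof -
  interpret square_subgroup S by fact
  interpret I: square_subgroup "corr_image C S" by (rule square_subgroup_corr_image) fact
  have "basic_part (corr_image C S) = corr_image C (S \<union> uminus ` S)"
    using basic_part_corr_image[OF S] e unfolding exceptional_def by simp
  also have "\<dots> = corr_image C S \<union> uminus ` corr_image C S"
    unfolding uminus_corr_image by (auto simp: corr_image_def)
  finally have b: "basic_part (corr_image C S) = corr_image C S \<union> uminus ` corr_image C S" .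
  have m1: "- 1 \<in> corr_image C S \<longleftrightarrow> - 1 \<in> S"
    by (rule corr_image_iff[OF S corr_uminus[OF corr_one]])
  have "s' + t' \<in> corr_image C S"
    if n: "- 1 \<notin> S" and s': "s' \<in> corr_image C S" and t': "t' \<in> corr_image C S" for s' t'
  proof -
    obtain s t where s: "s \<in> S" "C s s'" and t: "t \<in> S" "C t t'"
      using s' t' unfolding corr_image_def by blast
    have "t' \<noteq> - s' * (z * z)" if z: "z \<noteq> 0" for z
    proof
      assume "t' = - s' * (z * z)"
      then have "(s' * (z * z)) * - 1 \<in> corr_image C S" using t' by simp
      then have "- 1 \<in> corr_image C S" using I.mult_cancel I.mult_mem s' I.square_mem[OF z] by blast
      then show False using m1 n by blast
    qed
    then obtain c where c: "C c (s' + t')" and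
      "c = s \<or> c = t \<or> (\<exists>a b. a \<noteq> 0 \<and> b \<noteq> 0 \<and> c = s * (a * a) + t * (b * b))"
      using corr_add[OF s(2) t(2)] by blast
    moreover have "\<forall>s\<in>S. \<forall>t\<in>S. s + t \<in> S" using e n unfolding exceptional_def by blast
    ultimately have "c \<in> S" using s t mult_mem square_mem by auto
    then show ?thesis using c unfolding corr_image_def by blast
  qed
  then show ?thesis using b m1 unfolding exceptional_def by blast
qed

lemma exceptional_corr_image_iff:
  assumes S: "square_subgroup S" shows "exceptional (corr_image C S) \<longleftrightarrow> exceptional S"
proof -
  interpret conv: class_correspondence "\<lambda>y x. C x y" by (rule converse)
  show ?thesis
    using conv.exceptional_corr_image[OF square_subgroup_corr_image[OF S]]
      exceptional_corr_image[OF S] corr_image_converse[OF S] by auto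
qed

end

section \<open>The correspondence given by a hyperfield isomorphism\<close>

lemma quad_class_eq_iff:
  assumes "a \<noteq> 0"
  shows "quad_class a = quad_class b \<longleftrightarrow> (\<exists>z. z \<noteq> 0 \<and> b = a * (z * z))"
proof
  assume "quad_class a = quad_class b"
  moreover have "b \<in> quad_class b" unfolding quad_class_eq by (intro CollectI exI[of _ 1]) simp
  ultimately have "b \<in> quad_class a" by simp
  then show "\<exists>z. z \<noteq> 0 \<and> b = a * (z * z)" unfolding quad_class_eq by (auto simp: power2_eq_square)
next
  assume "\<exists>z. z \<noteq> 0 \<and> b = a * (z * z)"
  then obtain z where z: "z \<noteq> 0" "b = a * (z * z)" by blast
  have "a * x\<^sup>2 = b * (x / z)\<^sup>2" "b * x\<^sup>2 = a * (z * x)\<^sup>2" for x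
    using z by (simp_all add: field_simps power2_eq_square)
  then show "quad_class a = quad_class b"
    unfolding quad_class_eq using z(1) by (metis (no_types, opaque_lifting) divide_eq_0_iff mult_eq_0_iff)
qed

lemma quad_class_eq_zero_iff: "quad_class a = quad_class 0 \<longleftrightarrow> a = 0"
  using quad_class_eq_iff[of a 0] by auto

text \<open>For classes that are not opposite, \<open>quad_add\<close> consists of the two classes
  and the represented sums, so membership of a sum can be moved across \<open>\<alpha>\<close>. For
  opposite classes \<open>quad_add\<close> is the whole carrier and says nothing, whence the side
  conditions in the two addition axioms.\<close>

lemma class_correspondence_hyperfield_iso:
  fixes \<alpha> :: "'a::field set \<Rightarrow> 'b::field set"
  assumes iso: "hyperfield_iso quad_hyperfield quad_hyperfield \<alpha>"
  shows "class_correspondence (\<lambda>x y. x \<noteq> 0 \<and> y \<noteq> 0 \<and> \<alpha> (quad_class x) = quad_class y)"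
proof -
  have qc: "quad_class x \<in> quad_carrier" for x :: "'c::field" by (simp add: quad_carrier_eq)
  have bij: "bij_betw \<alpha> quad_carrier quad_carrier"
    and zero: "\<alpha> (quad_class 0) = quad_class 0" and one: "\<alpha> (quad_class 1) = quad_class 1"
    using iso by (auto simp: hyperfield_iso_def quad_hyperfield_def quad_class_0 quad_class_1)
  have inj: "\<alpha> (quad_class x) = \<alpha> (quad_class y) \<longleftrightarrow> quad_class x = quad_class y" for x y
    using bij_betw_imp_inj_on[OF bij] qc by (auto dest: inj_onD)
  have ex: "\<exists>y. \<alpha> (quad_class x) = quad_class y" for x
    using bij_betw_apply[OF bij qc] unfolding quad_carrier_eq by blast
  have ex': "\<exists>x. \<alpha> (quad_class x) = quad_class y" for y
  proof -
    have "quad_class y \<in> \<alpha> ` quad_carrier" using bij_betw_imp_surj_on[OF bij] qc by blast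
    then show ?thesis unfolding quad_carrier_eq by force
  qed
  have hom: "\<alpha> (A <#>\<^bsub>mult_group\<^esub> B) = \<alpha> A <#>\<^bsub>mult_group\<^esub> \<alpha> B"
    "\<alpha> (uminus ` A) = uminus ` \<alpha> A" "\<alpha> ` quad_add A B = quad_add (\<alpha> A) (\<alpha> B)"
    if "A \<in> quad_carrier" "B \<in> quad_carrier" for A B
    using iso that by (simp_all add: hyperfield_iso_def quad_hyperfield_def)
  have mult: "\<alpha> (quad_class (x * y)) = quad_class (x' * y')"
    if "\<alpha> (quad_class x) = quad_class x'" "\<alpha> (quad_class y) = quad_class y'" for x y x' y'
    using hom(1)[OF qc qc, of x y] that by (simp add: quad_mult_classes)
  have neg: "\<alpha> (quad_class (- x)) = quad_class (- y)" if "\<alpha> (quad_class x) = quad_class y" for x y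
    using hom(2)[OF qc qc, of x] that by (simp add: quad_neg_class)
  have add: "\<alpha> ` quad_add (quad_class x) (quad_class y) = quad_add (quad_class x') (quad_class y')"
    if "\<alpha> (quad_class x) = quad_class x'" "\<alpha> (quad_class y) = quad_class y'" for x y x' y'
    using hom(3)[OF qc qc, of x y] that by simp
  have nz: "x = 0 \<longleftrightarrow> y = 0" if "\<alpha> (quad_class x) = quad_class y" for x y
    using that inj[of x 0] zero quad_class_eq_zero_iff by metis
  have sum: "quad_add (quad_class s) (quad_class t) = {quad_class s, quad_class t} \<union>
      {quad_class (s * x\<^sup>2 + t * y\<^sup>2) | x y. x \<noteq> 0 \<and> y \<noteq> 0}"
    if "s \<noteq> 0" "t \<noteq> 0" "quad_class t \<noteq> quad_class (- s)" for s t :: "'c::field"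
    using quad_add_classes[OF that(1,2)] that(3) by simp
  have sum_mem: "quad_class (s + t) \<in> quad_add (quad_class s) (quad_class t)"
    if "s \<noteq> 0" "t \<noteq> 0" "quad_class t \<noteq> quad_class (- s)" for s t :: "'c::field"
  proof -
    have "quad_class (s + t) = quad_class (s * 1\<^sup>2 + t * 1\<^sup>2)" by simp
    then show ?thesis unfolding sum[OF that] using one_neq_zero by blast
  qed
  have sum_cases: "\<exists>c. A = quad_class c \<and> (c = s \<or> c = t \<or>
      (\<exists>a b. a \<noteq> 0 \<and> b \<noteq> 0 \<and> c = s * (a * a) + t * (b * b)))"
    if "s \<noteq> 0" "t \<noteq> 0" "quad_class t \<noteq> quad_class (- s)"
      "A \<in> quad_add (quad_class s) (quad_class t)" for s t :: "'c::field" and A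
    using that(4) unfolding sum[OF that(1-3)] power2_eq_square by blast
  have ne: "quad_class t \<noteq> quad_class (- s) \<and> s + t \<noteq> 0"
    if "s \<noteq> 0" "\<And>z. z \<noteq> 0 \<Longrightarrow> t \<noteq> - s * (z * z)" for s t :: "'c::field"
    using that(2)[of 1] that(1) quad_class_eq_iff[of "- s" t] that(2)
    by (auto simp: add_eq_0_iff)
  show ?thesis
  proof
    fix s t :: 'a and s' t' :: 'b
    assume s: "s \<noteq> 0 \<and> s' \<noteq> 0 \<and> \<alpha> (quad_class s) = quad_class s'"
      and t: "t \<noteq> 0 \<and> t' \<noteq> 0 \<and> \<alpha> (quad_class t) = quad_class t'"
    have eq: "\<alpha> ` quad_add (quad_class s) (quad_class t) = quad_add (quad_class s') (quad_class t')"
      using add s t by blast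
    have iff: "quad_class t' = quad_class (- s') \<longleftrightarrow> quad_class t = quad_class (- s)"
      using neg[of s s'] inj[of t "- s"] s t by simp
    {
      assume n': "\<And>z. z \<noteq> 0 \<Longrightarrow> t' \<noteq> - s' * (z * z)"
      have 1: "quad_class t' \<noteq> quad_class (- s')" "s' + t' \<noteq> 0" using ne[OF _ n'] s by auto
      then have "quad_class (s' + t') \<in> \<alpha> ` quad_add (quad_class s) (quad_class t)"
        unfolding eq using sum_mem s t by blast
      then obtain A where A: "quad_class (s' + t') = \<alpha> A" "A \<in> quad_add (quad_class s) (quad_class t)"
        by blast
      moreover have "s \<noteq> 0" "t \<noteq> 0" "quad_class t \<noteq> quad_class (- s)" using s t 1(1) iff by auto
      ultimately obtain c where c: "\<alpha> (quad_class c) = quad_class (s' + t')" "c = s \<or> c = t \<or>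
          (\<exists>a b. a \<noteq> 0 \<and> b \<noteq> 0 \<and> c = s * (a * a) + t * (b * b))"
        using sum_cases[of s t A] by auto
      then show "\<exists>c. (c \<noteq> 0 \<and> s' + t' \<noteq> 0 \<and> \<alpha> (quad_class c) = quad_class (s' + t')) \<and>
          (c = s \<or> c = t \<or> (\<exists>a b. a \<noteq> 0 \<and> b \<noteq> 0 \<and> c = s * (a * a) + t * (b * b)))"
        using 1(2) nz[OF c(1)] by blast
    next
      assume n: "\<And>z. z \<noteq> 0 \<Longrightarrow> t \<noteq> - s * (z * z)"
      have 1: "quad_class t \<noteq> quad_class (- s)" "s + t \<noteq> 0" using ne[OF _ n] s by auto
      then have "\<alpha> (quad_class (s + t)) \<in> quad_add (quad_class s') (quad_class t')"
        unfolding eq[symmetric] using sum_mem s t by blast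
      moreover have "s' \<noteq> 0" "t' \<noteq> 0" "quad_class t' \<noteq> quad_class (- s')" using s t 1(1) iff by auto
      ultimately obtain c where c: "\<alpha> (quad_class (s + t)) = quad_class c" "c = s' \<or> c = t' \<or>
          (\<exists>a b. a \<noteq> 0 \<and> b \<noteq> 0 \<and> c = s' * (a * a) + t' * (b * b))"
        using sum_cases[of s' t' "\<alpha> (quad_class (s + t))"] by auto
      then show "\<exists>c. (s + t \<noteq> 0 \<and> c \<noteq> 0 \<and> \<alpha> (quad_class (s + t)) = quad_class c) \<and>
          (c = s' \<or> c = t' \<or> (\<exists>a b. a \<noteq> 0 \<and> b \<noteq> 0 \<and> c = s' * (a * a) + t' * (b * b)))"
        using 1(2) nz[OF c(1)] by blast
    }
  next
    fix x x' y
    assume "x \<noteq> 0 \<and> y \<noteq> 0 \<and> \<alpha> (quad_class x) = quad_class y"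
      "x' \<noteq> 0 \<and> y \<noteq> 0 \<and> \<alpha> (quad_class x') = quad_class y"
    then show "\<exists>z. z \<noteq> 0 \<and> x' = x * (z * z)" using inj[of x x'] quad_class_eq_iff[of x x'] by simp
  next
    fix x y y'
    assume "x \<noteq> 0 \<and> y \<noteq> 0 \<and> \<alpha> (quad_class x) = quad_class y"
      "x \<noteq> 0 \<and> y' \<noteq> 0 \<and> \<alpha> (quad_class x) = quad_class y'"
    then show "\<exists>z. z \<noteq> 0 \<and> y' = y * (z * z)" using quad_class_eq_iff[of y y'] by simp
  next
    fix x :: 'a assume "x \<noteq> 0"
    then show "\<exists>y. x \<noteq> 0 \<and> y \<noteq> 0 \<and> \<alpha> (quad_class x) = quad_class y" using ex[of x] nz by blast
  next
    fix y :: 'b assume "y \<noteq> 0"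
    then show "\<exists>x. x \<noteq> 0 \<and> y \<noteq> 0 \<and> \<alpha> (quad_class x) = quad_class y" using ex'[of y] nz by blast
  qed (use one mult neg in auto)
qed

section \<open>Index computations\<close>

lemma quotient_set_eq: "quotient_set T S = (\<lambda>a. (\<lambda>s. s * a) ` S) ` T"
  unfolding quotient_set_def FactGroup_def RCOSETS_def r_coset_def mult_group_def by auto

lemma quotient_set_nonzero_squares: "quotient_set S nonzero_squares = quad_class ` S"
  unfolding quotient_set_eq quad_class_eq nonzero_squares_def by (auto simp: image_iff) (auto simp: mult.commute)

lemma (in square_subgroup) coset_eq_iff:
  assumes "x \<noteq> 0" "y \<noteq> 0"
  shows "(\<lambda>s. s * x) ` S = (\<lambda>s. s * y) ` S \<longleftrightarrow> x * y \<in> S"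
proof
  assume "(\<lambda>s. s * x) ` S = (\<lambda>s. s * y) ` S"
  then have "1 * x \<in> (\<lambda>s. s * y) ` S" using one_mem by blast
  then obtain s where "s \<in> S" "x = s * y" by auto
  then have "x * y = s * (y * y)" by (simp add: ac_simps)
  then show "x * y \<in> S" using mult_mem[OF \<open>s \<in> S\<close> square_mem[OF assms(2)]] by metis
next
  have sub: "(\<lambda>s. s * x) ` S \<subseteq> (\<lambda>s. s * y) ` S" if "x * y \<in> S" "y \<noteq> 0" for x y
  proof
    fix z assume "z \<in> (\<lambda>s. s * x) ` S"
    then obtain s where s: "s \<in> S" "z = s * x" by blast
    have "x / y \<in> S" using that divide_iff by blast
    then have "s * (x / y) \<in> S" using s mult_mem by blast
    moreover have "z = s * (x / y) * y" using s that(2) by simp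
    ultimately show "z \<in> (\<lambda>s. s * y) ` S" by blast
  qed
  assume "x * y \<in> S"
  then show "(\<lambda>s. s * x) ` S = (\<lambda>s. s * y) ` S"
    using sub[of x y] sub[of y x] assms by (auto simp: mult.commute)
qed

text \<open>A coset is sent to the coset of \<open>\<phi>\<close> at a chosen representative; the
  second condition on \<open>\<phi>\<close> makes this injective.\<close>

lemma quotient_set_lepoll:
  fixes S :: "'a::field set" and S' :: "'b::field set"
  assumes S: "square_subgroup S" and S': "square_subgroup S'"
    and \<phi>: "\<And>x. x \<noteq> 0 \<Longrightarrow> \<phi> x \<noteq> 0"
      "\<And>x y. \<lbrakk>x \<noteq> 0; y \<noteq> 0; \<phi> x * \<phi> y \<in> S'\<rbrakk> \<Longrightarrow> x * y \<in> S"
  shows "quotient_set (carrier mult_group) S \<lesssim> quotient_set (carrier mult_group) S'"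
proof -
  interpret S: square_subgroup S by fact
  interpret S': square_subgroup S' by fact
  define rep where "rep A = (SOME x. x \<noteq> 0 \<and> A = (\<lambda>s. s * x) ` S)" for A
  define f where "f A = (\<lambda>s. s * \<phi> (rep A)) ` S'" for A
  have rep: "rep A \<noteq> 0" "(\<lambda>s. s * rep A) ` S = A"
    if A: "A \<in> quotient_set (carrier mult_group) S" for A
  proof -
    obtain x where "x \<noteq> 0 \<and> A = (\<lambda>s. s * x) ` S"
      using A unfolding quotient_set_eq by (auto simp: mult_group_def)
    then have "rep A \<noteq> 0 \<and> A = (\<lambda>s. s * rep A) ` S" unfolding rep_def by (rule someI)
    then show "rep A \<noteq> 0" "(\<lambda>s. s * rep A) ` S = A" by auto
  qed
  have "inj_on f (quotient_set (carrier mult_group) S)"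
  proof (rule inj_onI)
    fix A B assume A: "A \<in> quotient_set (carrier mult_group) S"
      and B: "B \<in> quotient_set (carrier mult_group) S" and eq: "f A = f B"
    have nz: "rep A \<noteq> 0" "rep B \<noteq> 0" using rep(1) A B by auto
    have "\<phi> (rep A) * \<phi> (rep B) \<in> S'"
      using eq S'.coset_eq_iff[OF \<phi>(1)[OF nz(1)] \<phi>(1)[OF nz(2)]] unfolding f_def by blast
    then have "rep A * rep B \<in> S" by (rule \<phi>(2)[OF nz])
    then show "A = B" using S.coset_eq_iff[OF nz] rep(2)[OF A] rep(2)[OF B] by simp
  qed
  moreover have "f A \<in> quotient_set (carrier mult_group) S'"
    if "A \<in> quotient_set (carrier mult_group) S" for A
    using \<phi>(1)[OF rep(1)[OF that]] unfolding quotient_set_eq f_def by (auto simp: mult_group_def)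
  ultimately show ?thesis unfolding lepoll_def by blast
qed

text \<open>
  If \<open>V = T \<union> gT\<close> is not contained in \<open>H\<close>, pick \<open>h \<in> H - V\<close>. A coset of \<open>W = H \<union> gH\<close> with
  representative \<open>r\<close> contains the two cosets \<open>rH\<close>, \<open>rgH\<close> of \<open>H\<close>; they are sent to
  \<open>rV\<close> and \<open>rhV\<close>.
\<close>
lemma index_le:
  assumes T: "square_subgroup T" and H: "square_subgroup H" and V: "square_subgroup V"
    and TH: "T \<subset> H" and g: "\<And>x. x \<in> V \<Longrightarrow> x \<in> T \<or> x * g \<in> T"
  shows "\<exists>\<psi>. (\<forall>x. x \<noteq> 0 \<longrightarrow> \<psi> x \<noteq> 0) \<and>
    (\<forall>x y. x \<noteq> 0 \<longrightarrow> y \<noteq> 0 \<longrightarrow> \<psi> x * \<psi> y \<in> V \<longrightarrow> x * y \<in> H)"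
proof (cases "V \<subseteq> H")
  case True
  then show ?thesis by (intro exI[of _ "\<lambda>x. x"]) blast
next
  case False
  interpret T: square_subgroup T by fact
  interpret H: square_subgroup H by fact
  interpret V: square_subgroup V by fact
  obtain k where k: "k \<in> V" "k \<notin> H" using False by blast
  then have kg: "k * g \<in> T" using g TH by blast
  then have g0: "g \<noteq> 0" using T.zero_notin by auto
  have gH: "g \<notin> H" using H.same_class_mem[of k g] kg TH k by blast
  have "\<not> H \<subseteq> V"
  proof
    assume "H \<subseteq> V"
    moreover obtain h where "h \<in> H" "h \<notin> T" using TH by blast
    ultimately have "h * g \<in> T" using g by blast
    then show False using H.mult_cancel \<open>h \<in> H\<close> TH gH by blast
  qed
  then obtain h where h: "h \<in> H" "h \<notin> V" by blast
  have h0: "h \<noteq> 0" using h H.nonzero by blast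
  define W where "W = {x. x \<in> H \<or> x * g \<in> H}"
  interpret W: square_subgroup W
  proof
    fix x y
    have 1: "x * y * g \<in> H" if "x * g \<in> H" "y \<in> H" for x y
      using H.mult_mem[OF that] by (simp add: ac_simps)
    have 2: "x * y \<in> H" if "x * g \<in> H" "y * g \<in> H" for x y
      using that H.same_class_trans[of x g y] by (simp add: mult.commute)
    show "x * y \<in> W" if "x \<in> W" "y \<in> W"
      using that 1[of x y] 1[of y x] 2 H.mult_mem by (auto simp: W_def mult.commute)
  qed (use H.square_mem H.zero_notin in \<open>auto simp: W_def\<close>)
  have VW: "V \<subseteq> W" using g TH unfolding W_def by blast
  have hW: "h \<in> W" using h unfolding W_def by blast
  \<comment> \<open>The set chosen from depends only on the coset of \<open>x\<close> modulo
    \<open>W\<close>, so \<open>r\<close> is constant on these cosets.\<close>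
  define r where "r x = (SOME y. y \<in> {y. x * y \<in> W})" for x
  have r: "x * r x \<in> W" if x: "x \<noteq> 0" for x
  proof -
    have "\<exists>y. y \<in> {y. x * y \<in> W}" using W.square_mem[OF x] by blast
    then have "r x \<in> {y. x * y \<in> W}" unfolding r_def by (rule someI_ex)
    then show ?thesis by simp
  qed
  have r_cong: "r x = r y" if xy: "x * y \<in> W" for x y
  proof -
    have "{z. x * z \<in> W} = {z. y * z \<in> W}"
      using W.same_class_trans[of x y] W.same_class_trans[of y x] xy by (auto simp: mult.commute)
    then show ?thesis unfolding r_def by simp
  qed
  have r0: "r x \<noteq> 0" if "x \<noteq> 0" for x using r[OF that] W.zero_notin by auto
  \<comment> \<open>The factor \<open>h \<in> W - V\<close> separates the two cosets of
    \<open>H\<close> inside one coset of \<open>W\<close>: it keeps the coset modulo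
    \<open>W\<close> and changes the one modulo \<open>V\<close>.\<close>
  define \<psi> where "\<psi> x = (if x * r x \<in> H then r x else r x * h)" for x
  have \<psi>W: "x * \<psi> x \<in> W" if "x \<noteq> 0" for x
    using W.mult_mem[OF r[OF that] hW] r[OF that] unfolding \<psi>_def by (simp add: mult.assoc)
  show ?thesis
  proof (intro exI[of _ \<psi>] conjI allI impI)
    show "\<psi> x \<noteq> 0" if "x \<noteq> 0" for x using that r0 h0 unfolding \<psi>_def by simp
    fix x y assume x: "x \<noteq> 0" and y: "y \<noteq> 0" and xy: "\<psi> x * \<psi> y \<in> V"
    have "x * \<psi> y \<in> W" using W.same_class_trans[OF \<psi>W[OF x]] xy VW by blast
    moreover have "\<psi> y * y \<in> W" using \<psi>W[OF y] by (simp add: mult.commute)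
    ultimately have eq: "r x = r y" using r_cong W.same_class_trans by blast
    let ?r = "r x"
    have n: "?r * ?r * h \<notin> V" using V.square_cancel r0[OF x] h by blast
    then have "(x * ?r \<in> H) = (y * ?r \<in> H)"
      using xy eq unfolding \<psi>_def by (auto simp: ac_simps split: if_splits)
    then consider "x * ?r \<in> H" "y * ?r \<in> H" | "x * ?r \<notin> H" "y * ?r \<notin> H" by blast
    then show "x * y \<in> H"
    proof cases
      case 1
      then show ?thesis using H.same_class_trans[of x ?r y] by (simp add: mult.commute)
    next
      case 2
      then have "x * (?r * g) \<in> H" "y * (?r * g) \<in> H"
        using r[OF x] r[OF y] eq unfolding W_def by (auto simp: mult.assoc)
      then show ?thesis using H.same_class_trans[of x "?r * g" y] by (simp add: mult.commute)
    qed
  qed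
qed

theorem theorem5p3:
  fixes \<alpha> :: "'a::field set \<Rightarrow> 'b::field set"
    and G :: "'g ordered_monoid" and v :: "'a \<Rightarrow> 'g"
  assumes "hyperfield_iso quad_hyperfield quad_hyperfield \<alpha>"
    and "field_valuation G v"
    and "finitely_generated_subgroup G (value_group v)"
    and "(basic_part (one_units_squares G v) = units_squares G v \<and>
          \<not> exceptional (one_units_squares G v)) \<or>
         (basic_part (one_units_squares G v) = one_units_squares G v \<and>
          card (quotient_set (units_squares G v) (one_units_squares G v)) = 2)"
  shows "\<exists>(H :: 'b set ordered_monoid) (w :: 'b \<Rightarrow> 'b set).
    field_valuation H w \<and>
    \<alpha> ` quotient_set (one_units_squares G v) nonzero_squares =
      quotient_set (one_units_squares H w) nonzero_squares \<and>
    quotient_set (carrier mult_group) (units_squares G v) \<lesssim>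
      quotient_set (carrier mult_group) (units_squares H w) \<and>
    (basic_part (one_units_squares G v) = units_squares G v \<and>
     \<not> exceptional (one_units_squares G v) \<longrightarrow>
      \<alpha> ` quotient_set (units_squares G v) nonzero_squares =
        quotient_set (units_squares H w) nonzero_squares)"
proof -
  define C where "C x y \<longleftrightarrow> x \<noteq> 0 \<and> y \<noteq> 0 \<and> \<alpha> (quad_class x) = quad_class y" for x y
  interpret class_correspondence C
    unfolding C_def by (rule class_correspondence_hyperfield_iso) fact
  interpret conv: class_correspondence "\<lambda>y x. C x y" by (rule converse)
  interpret V: field_valuation G v by fact
  interpret R: val_subring "val_ring G v" by (rule V.val_subring_val_ring)
  define T where "T = one_units_squares G v"
  define U where "U = units_squares G v"
  have T_eq: "T = one_unit_classes (val_ring G v)" unfolding T_def by (rule one_units_squares_eq)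
  have U_eq: "U = unit_classes (val_ring G v)" unfolding U_def by (rule units_squares_eq)
  interpret T: square_subgroup T unfolding T_eq by (rule R.square_subgroup_one_unit_classes)
  interpret U: square_subgroup U unfolding U_eq by (rule R.square_subgroup_unit_classes)
  interpret T': square_subgroup "corr_image C T"
    by (rule square_subgroup_corr_image[OF T.square_subgroup_axioms])
  interpret U': square_subgroup "corr_image C U"
    by (rule square_subgroup_corr_image[OF U.square_subgroup_axioms])
  have TU: "T \<subseteq> U" unfolding T_eq U_eq by (rule R.one_unit_classes_sub)
  define case_i where "case_i \<longleftrightarrow> basic_part T = U \<and> \<not> exceptional T"
  have ii: "basic_part T = T" "U \<noteq> T" if "\<not> case_i"
  proof -
    have h: "basic_part T = T" "card (quotient_set U T) = 2"
      using assms(4) that unfolding case_i_def T_def U_def by auto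
    then show "basic_part T = T" by blast
    show "U \<noteq> T"
    proof
      assume "U = T"
      moreover have "(\<lambda>s. s * a) ` T = (\<lambda>s. s * 1) ` T" if "a \<in> T" for a
        using T.coset_eq_iff[of a 1] that T.nonzero by simp
      ultimately have "quotient_set U T \<subseteq> {(\<lambda>s. s * 1) ` T}" unfolding quotient_set_eq by blast
      then have "card (quotient_set U T) \<le> 1" using card_mono[of "{(\<lambda>s. s * 1) ` T}"] by fastforce
      then show False using h by simp
    qed
  qed
  have bp: "basic_part (corr_image C T) = corr_image C (basic_part T)"
    by (rule basic_part_corr_image[OF T.square_subgroup_axioms])
  obtain R g' where R: "compatible (corr_image C T) R"
    and R_i: "case_i \<Longrightarrow> ring_units R \<subseteq> corr_image C U"
    and R_ii: "\<not> case_i \<Longrightarrow> \<forall>x\<in>ring_units R. x \<in> corr_image C T \<or> x * g' \<in> corr_image C T"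
  proof (cases case_i)
    case True
    then have "\<not> exceptional (corr_image C T)"
      using exceptional_corr_image_iff[OF T.square_subgroup_axioms] unfolding case_i_def by blast
    then show ?thesis
      using ex_compatible_unexceptional[OF T'.square_subgroup_axioms U'.square_subgroup_axioms] bp True that
      unfolding case_i_def by blast
  next
    case False
    \<comment> \<open>The image of \<open>T\<close> equals its own basic part here, so it serves as
      both members of the rigid pair, at the cost of the coset of \<open>g'\<close>.\<close>
    then show ?thesis
      using ex_compatible_basic_part[OF T'.square_subgroup_axioms T'.square_subgroup_axioms] bp ii that
      by (metis order_refl)
  qed
  interpret W: val_subring R using R unfolding compatible_def by blast
  define Tw where "Tw = one_unit_classes R"
  define Uw where "Uw = unit_classes R"
  interpret Tw: square_subgroup Tw unfolding Tw_def by (rule W.square_subgroup_one_unit_classes)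
  interpret Uw: square_subgroup Uw unfolding Uw_def by (rule W.square_subgroup_unit_classes)
  have Tw_sub: "Tw \<subseteq> corr_image C T"
    unfolding Tw_def one_unit_classes_def
    using R T'.mult_mem T'.square_mem unfolding compatible_def by blast
  define S where "S = corr_image (\<lambda>y x. C x y) Tw"
  define V where "V = corr_image (\<lambda>y x. C x y) Uw"
  have S: "square_subgroup S" and V: "square_subgroup V"
    unfolding S_def V_def
    using conv.square_subgroup_corr_image Tw.square_subgroup_axioms Uw.square_subgroup_axioms by blast+
  have ST: "S \<subseteq> T"
    using corr_image_mono[OF Tw_sub] corr_image_converse[OF T.square_subgroup_axioms] unfolding S_def by metis
  have bS: "basic_part S \<subseteq> V"
    unfolding S_def V_def conv.basic_part_corr_image[OF Tw.square_subgroup_axioms]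
    by (rule corr_image_mono) (use W.basic_part_one_unit_classes in \<open>simp add: Tw_def Uw_def\<close>)
  have Uw_i: "Uw \<subseteq> corr_image C U" if case_i
    unfolding Uw_def unit_classes_def using R_i[OF that] U'.mult_mem U'.square_mem by blast
  have V_i: "V \<subseteq> U" if case_i
    using corr_image_mono[OF Uw_i[OF that]] corr_image_converse[OF U.square_subgroup_axioms]
    unfolding V_def by metis
  have "\<exists>g. \<forall>x\<in>V. x \<in> T \<or> x * g \<in> T" if n: "\<not> case_i"
  proof -
    \<comment> \<open>\<open>g'\<close> is an arbitrary field element and may be \<open>0\<close>;
      then no \<open>y * g'\<close> is in the image of \<open>T\<close>, and any \<open>g\<close>
      will do.\<close>
    obtain g where g: "C g g' \<or> g' = 0" using right_total by blast
    have "x \<in> T \<or> x * g \<in> T" if x: "x \<in> V" for x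
    proof -
      obtain y where y: "y \<in> Uw" "C x y" using x unfolding V_def corr_image_def by blast
      then obtain u z where u: "u \<in> ring_units R" "z \<noteq> 0" "y = u * (z * z)"
        unfolding Uw_def unit_classes_def by blast
      have zz: "z * z \<in> corr_image C T" by (rule T'.square_mem) fact
      have "y * g' = (u * g') * (z * z)" using u by (simp add: ac_simps)
      then have "y \<in> corr_image C T \<or> y * g' \<in> corr_image C T"
        using R_ii[OF n] u T'.mult_mem[OF _ zz] by metis
      then show ?thesis
      proof
        assume "y \<in> corr_image C T"
        then show ?thesis using corr_image_iff[OF T.square_subgroup_axioms y(2)] by blast
      next
        assume yg: "y * g' \<in> corr_image C T"
        then have "C g g'" using g T'.zero_notin by auto
        then show ?thesis using corr_image_iff[OF T.square_subgroup_axioms corr_mult[OF y(2)]] yg by blast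
      qed
    qed
    then show ?thesis by blast
  qed
  then obtain g where V_ii: "\<not> case_i \<Longrightarrow> \<forall>x\<in>V. x \<in> T \<or> x * g \<in> T" by blast
  have "T \<subseteq> S"
    unfolding T_eq
    by (rule V.one_unit_classes_sub[OF assms(3) S _ V bS])
      (use ST ii V_i V_ii[unfolded T_eq U_eq] in \<open>auto simp: case_i_def T_eq U_eq\<close>)
  then have "S = T" using ST by blast
  then have Tw_eq: "Tw = corr_image C T"
    using conv.corr_image_converse[OF Tw.square_subgroup_axioms] unfolding S_def by simp
  \<comment> \<open>The cosets of \<open>U\<close> are compared with those of \<open>V\<close>, the
    preimage of \<open>Uw\<close>. If \<open>case_i\<close> fails, \<open>V\<close> may reach
    outside \<open>U\<close>.\<close>
  have "\<exists>\<psi>. (\<forall>x. x \<noteq> 0 \<longrightarrow> \<psi> x \<noteq> 0) \<and>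
    (\<forall>x y. x \<noteq> 0 \<longrightarrow> y \<noteq> 0 \<longrightarrow> \<psi> x * \<psi> y \<in> V \<longrightarrow> x * y \<in> U)"
  proof (cases case_i)
    case True
    then show ?thesis by (intro exI[of _ "\<lambda>x. x"]) (use V_i in blast)
  next
    case False
    have "T \<subset> U" using TU ii(2)[OF False] by blast
    then show ?thesis
      by (rule index_le[OF T.square_subgroup_axioms U.square_subgroup_axioms V]) (use V_ii[OF False] in blast)
  qed
  then obtain \<psi> where \<psi>: "\<And>x. x \<noteq> 0 \<Longrightarrow> \<psi> x \<noteq> 0"
    "\<And>x y. \<lbrakk>x \<noteq> 0; y \<noteq> 0; \<psi> x * \<psi> y \<in> V\<rbrakk> \<Longrightarrow> x * y \<in> U" by blast
  obtain f where f: "\<And>x. x \<noteq> 0 \<Longrightarrow> C x (f x)" using left_total by metis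
  have le: "quotient_set (carrier mult_group) U \<lesssim> quotient_set (carrier mult_group) Uw"
  proof (rule quotient_set_lepoll[OF U.square_subgroup_axioms Uw.square_subgroup_axioms])
    show "f (\<psi> x) \<noteq> 0" if "x \<noteq> 0" for x using f[OF \<psi>(1)[OF that]] corr_nonzero by blast
    fix x y assume x: "x \<noteq> 0" and y: "y \<noteq> 0" and "f (\<psi> x) * f (\<psi> y) \<in> Uw"
    moreover have "C (\<psi> x * \<psi> y) (f (\<psi> x) * f (\<psi> y))" using corr_mult f \<psi>(1) x y by blast
    ultimately have "\<psi> x * \<psi> y \<in> V" unfolding V_def corr_image_def by blast
    then show "x * y \<in> U" using \<psi>(2) x y by blast
  qed
  have image: "\<alpha> ` quotient_set A nonzero_squares = quotient_set (corr_image C A) nonzero_squares"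
    if A: "square_subgroup A" for A
  proof -
    have "\<alpha> (quad_class x) \<in> quad_class ` corr_image C A" if x: "x \<in> A" for x
      using left_total[OF square_subgroup.nonzero[OF A x]] x unfolding corr_image_def C_def by blast
    moreover have "quad_class y \<in> \<alpha> ` quad_class ` A" if y: "y \<in> corr_image C A" for y
      using y unfolding corr_image_def C_def by force
    ultimately show ?thesis unfolding quotient_set_nonzero_squares by blast
  qed
  \<comment> \<open>The image of \<open>U\<close> is that of the basic part of \<open>T\<close>,
    hence the basic part of \<open>Tw\<close>, which is contained in \<open>Uw\<close>; the converse
    inclusion came with the choice of \<open>R\<close>.\<close>
  have U_i: "corr_image C U = Uw" if case_i
  proof
    have "corr_image C U = basic_part Tw" using bp that Tw_eq unfolding case_i_def by simp
    then show "corr_image C U \<subseteq> Uw"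
      using W.basic_part_one_unit_classes unfolding Tw_def Uw_def by simp
  qed (rule Uw_i[OF that])
  have eqs: "one_units_squares (ring_value_group R) (unit_coset R) = Tw"
    "units_squares (ring_value_group R) (unit_coset R) = Uw"
    unfolding one_units_squares_eq units_squares_eq W.val_ring_unit_coset Tw_def Uw_def by (rule refl)+
  show ?thesis
    unfolding T_def[symmetric] U_def[symmetric] case_i_def[symmetric]
    by (rule exI[of _ "ring_value_group R"], rule exI[of _ "unit_coset R"])
      (use W.field_valuation_unit_coset le image[OF T.square_subgroup_axioms]
        image[OF U.square_subgroup_axioms] U_i Tw_eq in \<open>simp add: eqs\<close>)
qed

end
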